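(* Let $R$ be an effectively given Pr\"ufer domain. If the theory $T_R$ of $R$-modules is decidable, then $\mathrm{PP}^\star(R)$ is recursive.
   Context: A Pr\"ufer domain is a commutative domain all of whose localizations at maximal ideals are valuation domains. A domain $R$ is effectively given if it is countable and its elements can be listed as $a_0=0,a_1=1,a_2,\dots$ (possibly with repetitions) so that there are algorithms which, given $m,n$, decide whether $a_m=a_n$, produce indices of $a_m+a_n$ and $a_m a_n$, and decide whether $a_m$ divides $a_n$. Recursiveness is understood with respect to this enumeration. $T_R$ is the first-order theory of (right unital) $R$-modules. $\mathbb{N}$ = positive integers, $\mathbb{N}_0$ = non-negative integers, $\mathbb{P}$ = primes, $\mathrm{Span}_{\mathbb{N}_0}\{k_1,\dots,k_s\}$ = set of $\mathbb{N}_0$-linear combinations of the $k_i$. For $l\in\mathbb{N}$, $\mathrm{PP}_l(R)$ is the set of $(p,n,c_1,\dots,c_l,d)\in\mathbb{P}\times\mathbb{N}\times R^{l+1}$ such that there exist positive integers $s,k_1,\dots,k_s$ and maximal ideals $\mathfrak{m}_1,\dots,\mathfrak{m}_s$ of $R$ with $n\in\mathrm{Span}_{\mathbb{N}_0}\{k_1,\dots,k_s\}$ and, for every $i=1,\dots,s$: $|R/\mathfrak{m}_i|=p^{k_i}$, $c_j\in\mathfrak{m}_i$ for all $1\le j\le l$, and $d\notin\mathfrak{m}_i$. $\mathrm{PP}^\star(R)=\bigcup_{l\in\mathbb{N}}\mathrm{PP}_l(R)$. *)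

theory Defs
  imports
    "HOL-Library.Nat_Bijection"
    "HOL-Library.Countable_Set"
    "HOL-Computational_Algebra.Primes"
    "HOL-Algebra.Divisibility"
    "HOL-Algebra.QuotRing"
    "HOL-Algebra.Module"
begin

section \<open>Recursive functions and relations\<close>

text \<open>
  Total recursive functions, generated by composition, primitive recursion and minimization of
  regular functions. A function of arity \<open>k\<close> is represented on lists; its values on
  lists of length other than \<open>k\<close> are irrelevant (rule \<open>ext\<close>).
\<close>

inductive recursive_fun :: "nat \<Rightarrow> (nat list \<Rightarrow> nat) \<Rightarrow> bool" where
  zero: "recursive_fun k (\<lambda>xs. 0)"
| succ: "recursive_fun 1 (\<lambda>xs. Suc (xs ! 0))"
| proj: "i < k \<Longrightarrow> recursive_fun k (\<lambda>xs. xs ! i)"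
| comp: "recursive_fun (length gs) f \<Longrightarrow> (\<And>g. g \<in> set gs \<Longrightarrow> recursive_fun k g)
    \<Longrightarrow> recursive_fun k (\<lambda>xs. f (map (\<lambda>g. g xs) gs))"
| prec: "recursive_fun k f \<Longrightarrow> recursive_fun (Suc (Suc k)) g
    \<Longrightarrow> recursive_fun (Suc k)
          (\<lambda>xs. rec_nat (f (tl xs)) (\<lambda>n r. g (n # r # tl xs)) (hd xs))"
| minim: "recursive_fun (Suc k) f \<Longrightarrow> (\<And>xs. length xs = k \<Longrightarrow> \<exists>n. f (n # xs) = 0)
    \<Longrightarrow> recursive_fun k (\<lambda>xs. LEAST n. f (n # xs) = 0)"
| ext: "recursive_fun k f \<Longrightarrow> (\<And>xs. length xs = k \<Longrightarrow> g xs = f xs) \<Longrightarrow> recursive_fun k g"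

definition recursive_rel :: "nat \<Rightarrow> (nat list \<Rightarrow> bool) \<Rightarrow> bool" where
  "recursive_rel k P \<longleftrightarrow> recursive_fun k (\<lambda>xs. of_bool (P xs))"

definition recursive_set :: "nat set \<Rightarrow> bool" where
  "recursive_set A \<longleftrightarrow> recursive_rel 1 (\<lambda>xs. xs ! 0 \<in> A)"


section \<open>Effectively given domains\<close>

definition effectively_given :: "('a, 'b) ring_scheme \<Rightarrow> (nat \<Rightarrow> 'a) \<Rightarrow> bool" where
  "effectively_given R a \<longleftrightarrow>
     domain R \<and> range a = carrier R \<and> a 0 = \<zero>\<^bsub>R\<^esub> \<and> a 1 = \<one>\<^bsub>R\<^esub> \<and>
     recursive_rel 2 (\<lambda>xs. a (xs ! 0) = a (xs ! 1)) \<and>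
     (\<exists>f. recursive_fun 2 f \<and> (\<forall>m n. a (f [m, n]) = a m \<oplus>\<^bsub>R\<^esub> a n)) \<and>
     (\<exists>g. recursive_fun 2 g \<and> (\<forall>m n. a (g [m, n]) = a m \<otimes>\<^bsub>R\<^esub> a n)) \<and>
     recursive_rel 2 (\<lambda>xs. a (xs ! 0) divides\<^bsub>R\<^esub> a (xs ! 1))"


section \<open>Pruefer domains\<close>

text \<open>
  The factor \<open>u\<close> is needed for general commutative rings; it can be cancelled if \<open>R\<close> is a domain and
  \<open>0 \<notin> S\<close>.
\<close>

definition fraction_rel :: "('a, 'b) ring_scheme \<Rightarrow> 'a set \<Rightarrow> (('a \<times> 'a) \<times> ('a \<times> 'a)) set" where
  "fraction_rel R S = {((a, s), (b, t)). a \<in> carrier R \<and> b \<in> carrier R \<and> s \<in> S \<and> t \<in> S \<and>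
     (\<exists>u\<in>S. u \<otimes>\<^bsub>R\<^esub> (a \<otimes>\<^bsub>R\<^esub> t) = u \<otimes>\<^bsub>R\<^esub> (b \<otimes>\<^bsub>R\<^esub> s))}"

definition fraction_ring :: "('a, 'b) ring_scheme \<Rightarrow> 'a set \<Rightarrow> ('a \<times> 'a) set ring" where
  "fraction_ring R S =
    \<lparr>carrier = (carrier R \<times> S) // fraction_rel R S,
     mult = (\<lambda>X Y. \<Union>(a, s)\<in>X. \<Union>(b, t)\<in>Y. fraction_rel R S `` {(a \<otimes>\<^bsub>R\<^esub> b, s \<otimes>\<^bsub>R\<^esub> t)}),
     one = fraction_rel R S `` {(\<one>\<^bsub>R\<^esub>, \<one>\<^bsub>R\<^esub>)},
     zero = fraction_rel R S `` {(\<zero>\<^bsub>R\<^esub>, \<one>\<^bsub>R\<^esub>)},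
     add = (\<lambda>X Y. \<Union>(a, s)\<in>X. \<Union>(b, t)\<in>Y.
              fraction_rel R S `` {((a \<otimes>\<^bsub>R\<^esub> t) \<oplus>\<^bsub>R\<^esub> (b \<otimes>\<^bsub>R\<^esub> s), s \<otimes>\<^bsub>R\<^esub> t)})\<rparr>"

definition localization :: "('a, 'b) ring_scheme \<Rightarrow> 'a set \<Rightarrow> ('a \<times> 'a) set ring" where
  "localization R P = fraction_ring R (carrier R - P)"

definition valuation_domain :: "('a, 'b) ring_scheme \<Rightarrow> bool" where
  "valuation_domain V \<longleftrightarrow> domain V \<and>
     (\<forall>a\<in>carrier V. \<forall>b\<in>carrier V. a divides\<^bsub>V\<^esub> b \<or> b divides\<^bsub>V\<^esub> a)"

definition prufer_domain :: "('a, 'b) ring_scheme \<Rightarrow> bool" where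
  "prufer_domain R \<longleftrightarrow> domain R \<and>
     (\<forall>\<mm>. maximalideal \<mm> R \<longrightarrow> valuation_domain (localization R \<mm>))"


section \<open>The first-order theory of modules\<close>

text \<open>
  The language has \<open>0\<close>, \<open>+\<close> and a unary function symbol \<open>Scal r\<close> for every ring element.
  The remaining connectives and the universal quantifier are definable.
\<close>

datatype (coeffs_tm: 'r) tm =
  Var nat | Zero | Plus "'r tm" "'r tm" | Scal 'r "'r tm"
  for map: map_tm

datatype (coeffs_fm: 'r) fm =
  Eq "'r tm" "'r tm" | Neg "'r fm" | Conj "'r fm" "'r fm" | Ex nat "'r fm"
  for map: map_fm

primrec fv_tm :: "'r tm \<Rightarrow> nat set" where
  "fv_tm (Var i) = {i}"
| "fv_tm Zero = {}"
| "fv_tm (Plus s t) = fv_tm s \<union> fv_tm t"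
| "fv_tm (Scal r t) = fv_tm t"

primrec fv :: "'r fm \<Rightarrow> nat set" where
  "fv (Eq s t) = fv_tm s \<union> fv_tm t"
| "fv (Neg \<phi>) = fv \<phi>"
| "fv (Conj \<phi> \<psi>) = fv \<phi> \<union> fv \<psi>"
| "fv (Ex i \<phi>) = fv \<phi> - {i}"

text \<open>
  Library modules are left modules; over a commutative ring they are the same as right modules,
  with \<open>r \<odot> x\<close> for \<open>x r\<close>.
\<close>

primrec val :: "('r, 'm, 'z) module_scheme \<Rightarrow> (nat \<Rightarrow> 'm) \<Rightarrow> 'r tm \<Rightarrow> 'm" where
  "val M v (Var i) = v i"
| "val M v Zero = \<zero>\<^bsub>M\<^esub>"
| "val M v (Plus s t) = val M v s \<oplus>\<^bsub>M\<^esub> val M v t"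
| "val M v (Scal r t) = r \<odot>\<^bsub>M\<^esub> val M v t"

primrec sat :: "('r, 'm, 'z) module_scheme \<Rightarrow> (nat \<Rightarrow> 'm) \<Rightarrow> 'r fm \<Rightarrow> bool" where
  "sat M v (Eq s t) \<longleftrightarrow> val M v s = val M v t"
| "sat M v (Neg \<phi>) \<longleftrightarrow> \<not> sat M v \<phi>"
| "sat M v (Conj \<phi> \<psi>) \<longleftrightarrow> sat M v \<phi> \<and> sat M v \<psi>"
| "sat M v (Ex i \<phi>) \<longleftrightarrow> (\<exists>x\<in>carrier M. sat M (v(i := x)) \<phi>)"

definition models :: "('r, 'm, 'z) module_scheme \<Rightarrow> 'r fm \<Rightarrow> bool" (infix \<open>\<Turnstile>\<close> 50) where
  "M \<Turnstile> \<phi> \<longleftrightarrow> (\<forall>v. range v \<subseteq> carrier M \<longrightarrow> sat M v \<phi>)"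

definition sentences :: "('r, 'b) ring_scheme \<Rightarrow> 'r fm set" where
  "sentences R = {\<phi>. coeffs_fm \<phi> \<subseteq> carrier R \<and> fv \<phi> = {}}"

text \<open>
  The sentences true in all \<open>R\<close>-modules. A HOL formula cannot quantify over carrier types, so the
  modules range over those with carrier in \<^typ>\<open>nat\<close>. For countable \<open>R\<close> this is no restriction,
  by the downward Loewenheim--Skolem theorem: by \<open>module_theory_sound\<close> below, the sentences in
  \<open>module_theory R\<close> hold in all \<open>R\<close>-modules, whatever the type of their elements.
\<close>

definition module_theory :: "('r, 'b) ring_scheme \<Rightarrow> 'r fm set" where
  "module_theory R = {\<phi> \<in> sentences R. \<forall>M :: ('r, nat) module. module R M \<longrightarrow> M \<Turnstile> \<phi>}"

subsection \<open>Independence of the carrier type\<close>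

lemma finite_fv_tm: "finite (fv_tm t)"
  by (induction t) auto

lemma finite_fv: "finite (fv \<phi>)"
  by (induction \<phi>) (auto simp: finite_fv_tm)

lemma fv_tm_map [simp]: "fv_tm (map_tm f t) = fv_tm t"
  by (induction t) auto

lemma fv_map [simp]: "fv (map_fm f \<phi>) = fv \<phi>"
  by (induction \<phi>) auto

lemma val_cong: "(\<And>i. i \<in> fv_tm t \<Longrightarrow> v i = w i) \<Longrightarrow> val M v t = val M w t"
  by (induction t) auto

lemma sat_cong: "(\<And>i. i \<in> fv \<phi> \<Longrightarrow> v i = w i) \<Longrightarrow> sat M v \<phi> \<longleftrightarrow> sat M w \<phi>"
proof (induction \<phi> arbitrary: v w)
  case (Eq s t)
  have "val M v s = val M w s" "val M v t = val M w t"
    by (rule val_cong; simp add: Eq)+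
  then show ?case by simp
next
  case (Neg \<phi>)
  have "sat M v \<phi> \<longleftrightarrow> sat M w \<phi>"
    by (rule Neg.IH) (simp add: Neg.prems)
  then show ?case by simp
next
  case (Conj \<phi> \<psi>)
  have "sat M v \<phi> \<longleftrightarrow> sat M w \<phi>"
    by (rule Conj.IH(1)) (simp add: Conj.prems)
  moreover have "sat M v \<psi> \<longleftrightarrow> sat M w \<psi>"
    by (rule Conj.IH(2)) (simp add: Conj.prems)
  ultimately show ?case by simp
next
  case (Ex i \<phi>)
  have "sat M (v(i := x)) \<phi> \<longleftrightarrow> sat M (w(i := x)) \<phi>" for x
    by (rule Ex.IH) (simp add: Ex.prems)
  then show ?case by simp
qed

instance tm :: (countable) countable
  by countable_datatype

instance fm :: (countable) countable
  by countable_datatype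

lemma fm_ex_map: "coeffs_fm \<phi> \<subseteq> range a \<Longrightarrow> \<exists>\<psi>. \<phi> = map_fm a \<psi>"
proof -
  assume "coeffs_fm \<phi> \<subseteq> range a"
  then have "map_fm (a \<circ> inv_into UNIV a) \<phi> = map_fm id \<phi>"
    by (intro fm.map_cong0) (auto simp: f_inv_into_f)
  then have "\<phi> = map_fm a (map_fm (inv_into UNIV a) \<phi>)"
    by (simp add: fm.map_comp fm.map_id)
  then show ?thesis by blast
qed

lemma ex_countable_elementary_submodule:
  fixes R :: "('r, 'b) ring_scheme" and M :: "('r, 'm, 'z) module_scheme" and a :: "nat \<Rightarrow> 'r"
  assumes "module R M" and a: "range a = carrier R"
  obtains N where
    "N \<subseteq> carrier M" and "countable N" and "\<zero>\<^bsub>M\<^esub> \<in> N"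
    and "\<And>x y. x \<in> N \<Longrightarrow> y \<in> N \<Longrightarrow> x \<oplus>\<^bsub>M\<^esub> y \<in> N"
    and "\<And>r x. r \<in> carrier R \<Longrightarrow> x \<in> N \<Longrightarrow> r \<odot>\<^bsub>M\<^esub> x \<in> N"
    and "\<And>v i \<phi>. range v \<subseteq> N \<Longrightarrow> sat M v (Ex i (map_fm a \<phi>))
        \<Longrightarrow> \<exists>x\<in>N. sat M (v(i := x)) (map_fm a \<phi>)"
proof -
  interpret module R M by fact
  define e where "e xs i = (if i < length xs then xs ! i else \<zero>\<^bsub>M\<^esub>)" for xs i
  define P where "P = (\<lambda>(\<phi>, i, xs) x. x \<in> carrier M \<and> sat M ((e xs)(i := x)) (map_fm a \<phi>))"
  define W where "W q = (if \<exists>x. P q x then SOME x. P q x else \<zero>\<^bsub>M\<^esub>)" for q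
  have P_W: "P q (W q)" if "P q x" for q x
    using someI[of "P q" x] that by (auto simp: W_def)
  have W_carrier: "W q \<in> carrier M" for q
  proof (cases "\<exists>x. P q x")
    case True
    then have "P q (W q)" using P_W by blast
    then show ?thesis by (auto simp: P_def split: prod.splits)
  qed (simp add: W_def)
  define S where "S = rec_nat {\<zero>\<^bsub>M\<^esub>} (\<lambda>_ A. A \<union> W ` (UNIV \<times> UNIV \<times> lists A))"
  have S0: "S 0 = {\<zero>\<^bsub>M\<^esub>}" and S_Suc: "S (Suc n) = S n \<union> W ` (UNIV \<times> UNIV \<times> lists (S n))" for n
    by (simp_all add: S_def)
  have S_mono: "m \<le> n \<Longrightarrow> S m \<subseteq> S n" for m n
    by (rule lift_Suc_mono_le) (simp_all add: S_Suc)
  have "S n \<subseteq> carrier M \<and> countable (S n)" for n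
    by (induction n) (auto simp: S0 S_Suc W_carrier)
  moreover define N where "N = (\<Union>n. S n)"
  ultimately have N: "N \<subseteq> carrier M" "countable N"
    by auto
  have zero: "\<zero>\<^bsub>M\<^esub> \<in> N"
    using S0 by (auto simp: N_def)
  have lists_N: "\<exists>n. xs \<in> lists (S n)" if "xs \<in> lists N" for xs
    using that
  proof (induction xs)
    case (Cons x xs)
    then obtain m n where "x \<in> S m" "xs \<in> lists (S n)" by (auto simp: N_def)
    with S_mono[of m "max m n"] S_mono[of n "max m n"] have "x # xs \<in> lists (S (max m n))"
      by auto
    then show ?case by blast
  qed auto
  have W_N: "W (\<phi>, i, xs) \<in> N" if xs: "xs \<in> lists N" for \<phi> i xs
  proof -
    obtain n where "xs \<in> lists (S n)" using lists_N[OF xs] ..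
    then have "W (\<phi>, i, xs) \<in> S (Suc n)" by (simp add: S_Suc)
    then show ?thesis by (auto simp: N_def)
  qed
  have witness: "\<exists>x\<in>N. sat M (v(i := x)) (map_fm a \<phi>)"
    if v: "range v \<subseteq> N" and ex: "sat M v (Ex i (map_fm a \<phi>))" for v i \<phi>
  proof -
    obtain n where n: "\<forall>j\<in>fv \<phi>. j < n"
      using finite_fv[of \<phi>] by (auto simp: finite_nat_set_iff_bounded)
    define xs where "xs = map v [0..<n]"
    have eq: "sat M ((e xs)(i := x)) (map_fm a \<phi>) \<longleftrightarrow> sat M (v(i := x)) (map_fm a \<phi>)" for x
      by (rule sat_cong) (use n in \<open>auto simp: e_def xs_def\<close>)
    from ex eq obtain x where "P (\<phi>, i, xs) x" by (auto simp: P_def)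
    then have "P (\<phi>, i, xs) (W (\<phi>, i, xs))" by (rule P_W)
    then have "sat M (v(i := W (\<phi>, i, xs))) (map_fm a \<phi>)" by (simp add: P_def eq)
    moreover have "xs \<in> lists N" using v by (auto simp: xs_def image_subset_iff)
    ultimately show ?thesis using W_N by blast
  qed
  have plus: "x \<oplus>\<^bsub>M\<^esub> y \<in> N" if "x \<in> N" "y \<in> N" for x y
  proof -
    have "\<exists>z\<in>N. sat M ((\<lambda>i. if i = 0 then x else y)(2 := z))
        (map_fm a (Eq (Var 2) (Plus (Var 0) (Var 1))))"
      by (rule witness) (use that N in auto)
    then show ?thesis by auto
  qed
  have scal: "r \<odot>\<^bsub>M\<^esub> x \<in> N" if r: "r \<in> carrier R" and x: "x \<in> N" for r x
  proof -
    obtain j where j: "r = a j" using r a by blast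
    have "\<exists>z\<in>N. sat M ((\<lambda>i. x)(1 := z)) (map_fm a (Eq (Var 1) (Scal j (Var 0))))"
      by (rule witness) (use that N j in auto)
    then show ?thesis by (auto simp: j)
  qed
  show thesis
    by (rule that[OF N zero plus scal witness])
qed

lemma ex_nat_module:
  fixes R :: "('r, 'b) ring_scheme" and M :: "('r, 'm, 'z) module_scheme"
  assumes M: "module R M" and R: "countable (carrier R)"
  shows "\<exists>M' :: ('r, nat) module. module R M' \<and> (\<forall>\<phi>\<in>sentences R. M' \<Turnstile> \<phi> \<longleftrightarrow> M \<Turnstile> \<phi>)"
proof -
  interpret module R M by fact
  have "carrier R \<noteq> {}"
    using R.zero_closed by blast
  with R obtain a :: "nat \<Rightarrow> 'r" where a: "range a = carrier R"
    using range_from_nat_into[of "carrier R"] by blast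
  obtain N where
    N: "N \<subseteq> carrier M" and count: "countable N" and zero: "\<zero>\<^bsub>M\<^esub> \<in> N"
    and plus: "\<And>x y. x \<in> N \<Longrightarrow> y \<in> N \<Longrightarrow> x \<oplus>\<^bsub>M\<^esub> y \<in> N"
    and scal: "\<And>r x. r \<in> carrier R \<Longrightarrow> x \<in> N \<Longrightarrow> r \<odot>\<^bsub>M\<^esub> x \<in> N"
    and witness: "\<And>v i \<phi>. range v \<subseteq> N \<Longrightarrow> sat M v (Ex i (map_fm a \<phi>))
        \<Longrightarrow> \<exists>x\<in>N. sat M (v(i := x)) (map_fm a \<phi>)"
    by (fact ex_countable_elementary_submodule[OF M a])
  obtain f :: "'m \<Rightarrow> nat" where f: "inj_on f N"
    using count by (auto simp: countable_def)
  define g where "g = inv_into N f"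
  have gf [simp]: "x \<in> N \<Longrightarrow> g (f x) = x" for x
    using f by (simp add: g_def)
  have f_eq [simp]: "x \<in> N \<Longrightarrow> y \<in> N \<Longrightarrow> f x = f y \<longleftrightarrow> x = y" for x y
    using f by (auto simp: inj_on_def)
  have NM [simp]: "x \<in> N \<Longrightarrow> x \<in> carrier M" for x
    using N by blast
  define M' :: "('r, nat) module" where
    "M' = \<lparr>carrier = f ` N, mult = undefined, one = undefined, zero = f \<zero>\<^bsub>M\<^esub>,
           add = \<lambda>x y. f (g x \<oplus>\<^bsub>M\<^esub> g y), smult = \<lambda>r x. f (r \<odot>\<^bsub>M\<^esub> g x)\<rparr>"
  note [simp] = zero plus scal
  have inverse: "\<exists>y\<in>N. y \<oplus>\<^bsub>M\<^esub> x = \<zero>\<^bsub>M\<^esub>" if "x \<in> N" for x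
  proof
    show "(\<ominus>\<^bsub>R\<^esub> \<one>\<^bsub>R\<^esub>) \<odot>\<^bsub>M\<^esub> x \<in> N" using that by simp
    show "(\<ominus>\<^bsub>R\<^esub> \<one>\<^bsub>R\<^esub>) \<odot>\<^bsub>M\<^esub> x \<oplus>\<^bsub>M\<^esub> x = \<zero>\<^bsub>M\<^esub>"
      using that by (simp add: smult_l_minus M.l_neg)
  qed
  have "module R M'"
  proof (rule moduleI)
    show "abelian_group M'"
    proof (rule abelian_groupI)
      fix x assume "x \<in> carrier M'"
      then show "\<exists>y\<in>carrier M'. y \<oplus>\<^bsub>M'\<^esub> x = \<zero>\<^bsub>M'\<^esub>"
        using inverse by (auto simp: M'_def)
    qed (auto simp: M'_def M.a_assoc M.a_comm M.a_lcomm)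
  qed (auto simp: M'_def R.is_cring smult_l_distr smult_r_distr smult_assoc1)
  have val: "val M v (map_tm a t) \<in> N \<and> val M' (\<lambda>j. f (v j)) (map_tm a t) = f (val M v (map_tm a t))"
    if "range v \<subseteq> N" for v t
  proof -
    have "v i \<in> N" "a i \<in> carrier R" for i using that a by auto
    then show ?thesis by (induction t) (simp_all add: M'_def)
  qed
  have sat: "sat M' (\<lambda>j. f (v j)) (map_fm a \<phi>) \<longleftrightarrow> sat M v (map_fm a \<phi>)" if "range v \<subseteq> N" for v \<phi>
    using that
  proof (induction \<phi> arbitrary: v)
    case (Eq s t)
    then show ?case using val[of v s] val[of v t] by simp
  next
    case (Ex i \<phi>)
    have *: "sat M' ((\<lambda>j. f (v j))(i := f x)) (map_fm a \<phi>) \<longleftrightarrow> sat M (v(i := x)) (map_fm a \<phi>)"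
      if "x \<in> N" for x
    proof -
      have "range (v(i := x)) \<subseteq> N" using Ex.prems that by auto
      then have "sat M' (\<lambda>j. f ((v(i := x)) j)) (map_fm a \<phi>) \<longleftrightarrow> sat M (v(i := x)) (map_fm a \<phi>)"
        by (rule Ex.IH)
      moreover have "(\<lambda>j. f ((v(i := x)) j)) = (\<lambda>j. f (v j))(i := f x)" by auto
      ultimately show ?thesis by (simp only:)
    qed
    have "sat M' (\<lambda>j. f (v j)) (map_fm a (Ex i \<phi>)) \<longleftrightarrow> (\<exists>x\<in>N. sat M (v(i := x)) (map_fm a \<phi>))"
      using * by (simp add: M'_def)
    also have "\<dots> \<longleftrightarrow> sat M v (map_fm a (Ex i \<phi>))"
      using witness[OF Ex.prems] by auto
    finally show ?case .
  qed simp_all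
  have "M' \<Turnstile> \<phi> \<longleftrightarrow> M \<Turnstile> \<phi>" if \<phi>: "\<phi> \<in> sentences R" for \<phi>
  proof -
    obtain \<psi> where \<psi>: "\<phi> = map_fm a \<psi>"
      using \<phi> a fm_ex_map[of \<phi> a] by (auto simp: sentences_def)
    have closed: "fv \<phi> = {}" using \<phi> by (simp add: sentences_def)
    define z where "z = (\<lambda>_::nat. \<zero>\<^bsub>M\<^esub>)"
    have z: "range z \<subseteq> N" by (auto simp: z_def)
    have cong: "sat M v \<phi> \<longleftrightarrow> sat M z \<phi>" "sat M' w \<phi> \<longleftrightarrow> sat M' (\<lambda>j. f (z j)) \<phi>" for v w
      by (rule sat_cong; simp add: closed)+
    have "range z \<subseteq> carrier M" using z N by (rule subset_trans)
    then have "M \<Turnstile> \<phi> \<longleftrightarrow> sat M z \<phi>"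
      unfolding models_def using cong(1) by blast
    moreover have "M' \<Turnstile> \<phi> \<longleftrightarrow> sat M' (\<lambda>j. f (z j)) \<phi>"
    proof -
      have "range (\<lambda>j. f (z j)) \<subseteq> carrier M'" using z by (auto simp: M'_def)
      then show ?thesis
        unfolding models_def using cong(2) by blast
    qed
    ultimately show ?thesis using sat[OF z, of \<psi>] by (simp add: \<psi>)
  qed
  with \<open>module R M'\<close> show ?thesis by blast
qed

lemma module_theory_sound:
  fixes M :: "('r, 'm, 'z) module_scheme"
  assumes "countable (carrier R)" and "\<phi> \<in> module_theory R" and "module R M"
  shows "M \<Turnstile> \<phi>"
  using ex_nat_module[OF assms(3,1)] assms(2) by (auto simp: module_theory_def)


section \<open>Recursiveness with respect to an enumeration\<close>

primrec code_tm :: "nat tm \<Rightarrow> nat" where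
  "code_tm (Var i) = prod_encode (0, i)"
| "code_tm Zero = prod_encode (1, 0)"
| "code_tm (Plus s t) = prod_encode (2, prod_encode (code_tm s, code_tm t))"
| "code_tm (Scal r t) = prod_encode (3, prod_encode (r, code_tm t))"

primrec code_fm :: "nat fm \<Rightarrow> nat" where
  "code_fm (Eq s t) = prod_encode (0, prod_encode (code_tm s, code_tm t))"
| "code_fm (Neg \<phi>) = prod_encode (1, code_fm \<phi>)"
| "code_fm (Conj \<phi> \<psi>) = prod_encode (2, prod_encode (code_fm \<phi>, code_fm \<psi>))"
| "code_fm (Ex i \<phi>) = prod_encode (3, prod_encode (i, code_fm \<phi>))"

text \<open>
  Formulas are coded through formulas in which the index \<open>i\<close> stands for the ring element \<open>a i\<close>;
  a formula has as many codes as there are ways to name its coefficients.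
\<close>

definition decidable_theory :: "(nat \<Rightarrow> 'r) \<Rightarrow> 'r fm set \<Rightarrow> bool" where
  "decidable_theory a T \<longleftrightarrow> recursive_set {code_fm \<phi> | \<phi>. map_fm a \<phi> \<in> T}"

definition recursive_tuples :: "(nat \<Rightarrow> 'r) \<Rightarrow> (nat \<times> nat \<times> 'r list \<times> 'r) set \<Rightarrow> bool" where
  "recursive_tuples a X \<longleftrightarrow>
     recursive_set {list_encode (p # n # j # is) | p n is j. (p, n, map a is, a j) \<in> X}"


section \<open>The set of tuples attached to residue fields\<close>

definition Span_nat :: "nat \<Rightarrow> (nat \<Rightarrow> nat) \<Rightarrow> nat set" where
  "Span_nat s k = {\<Sum>i<s. c i * k i | c. True}"

text \<open>
  A tuple \<open>(p, n, c\<^sub>1, \<dots>, c\<^sub>l, d)\<close> is written \<open>(p, n, [c\<^sub>1, \<dots>, c\<^sub>l], d)\<close>. Since \<open>card\<close> is \<open>0\<close> on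
  infinite sets, the equation \<open>card \<dots> = p ^ k i\<close> forces the residue field to be finite.
\<close>

definition PP :: "nat \<Rightarrow> ('r, 'b) ring_scheme \<Rightarrow> (nat \<times> nat \<times> 'r list \<times> 'r) set" where
  "PP l R = {(p, n, cs, d).
     Factorial_Ring.prime p \<and> n > 0 \<and> length cs = l \<and> set cs \<subseteq> carrier R \<and> d \<in> carrier R \<and>
     (\<exists>s k \<mm>. s > 0 \<and> (\<forall>i<s. k i > 0 \<and> maximalideal (\<mm> i) R) \<and> n \<in> Span_nat s k \<and>
        (\<forall>i<s. card (carrier (R Quot \<mm> i)) = p ^ k i \<and> (\<forall>c\<in>set cs. c \<in> \<mm> i) \<and> d \<notin> \<mm> i))}"

definition PP_star :: "('r, 'b) ring_scheme \<Rightarrow> (nat \<times> nat \<times> 'r list \<times> 'r) set" where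
  "PP_star R = (\<Union>l\<in>{1..}. PP l R)"

end

theory Submission
  imports Defs
begin

text \<open>
  A tuple \<open>(p, n, c\<^sub>1, \<dots>, c\<^sub>l, d)\<close> belongs to \<open>PP\<close> iff some \<open>R\<close>-module with exactly \<open>p ^ n\<close> elements is
  annihilated by all \<open>c\<^sub>i\<close> while \<open>d\<close> acts injectively on it. Given the maximal ideals, a direct sum of
  residue fields is such a module. Conversely, the composition factors of such a module are residue
  fields \<open>R/\<mm>\<close> of orders \<open>p ^ k\<close> whose exponents add up to \<open>n\<close>; every \<open>c\<^sub>i\<close> lies in \<open>\<mm>\<close>, and \<open>d\<close> does
  not, because it permutes every submodule. The existence of such a module says that the negation of
  a certain sentence, computable from the tuple, is not in \<open>T\<^sub>R\<close>.
\<close>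

section \<open>Recursive functions\<close>

text \<open>Decidability is transferred by a many-one reduction: a recursive map sends the code of a
  tuple to the code of one sentence, and apart from elementary checks on the tuple a single
  membership query settles the matter. Two obstacles shape the proof. The number
  \<open>p ^ n\<close> of elements and the number of annihilation conditions vary with the input, so
  the sentence has no fixed shape, and its code is built by primitive recursion on codes. Moreover,
  \<open>module_theory\<close> quantifies over modules on natural numbers, whereas direct sums of
  residue fields live on a type of functions; \<open>module_theory_sound\<close> bridges the gap.
  The span condition matches the cardinality condition because the coefficients of a combination of
  the \<open>k i\<close> serve as multiplicities of the residue fields. Conversely, composition
  factors may repeat, and each occurrence is listed separately.\<close>

lemma recursive_const: "recursive_fun k (\<lambda>_. c)"
proof (induction c)
  case 0
  show ?case by (rule recursive_fun.zero)
next
  case (Suc c)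
  then show ?case
    using recursive_fun.comp[of "[\<lambda>_. c]" "\<lambda>xs. Suc (xs ! 0)" k] recursive_fun.succ by simp
qed

lemma recursive_comp1:
  assumes "recursive_fun 1 (\<lambda>ys. h (ys ! 0))" "recursive_fun k f"
  shows "recursive_fun k (\<lambda>xs. h (f xs))"
  using recursive_fun.comp[of "[f]" "\<lambda>ys. h (ys ! 0)" k] assms by simp

lemma recursive_comp2:
  assumes "recursive_fun 2 (\<lambda>ys. h (ys ! 0) (ys ! 1))" "recursive_fun k f" "recursive_fun k g"
  shows "recursive_fun k (\<lambda>xs. h (f xs) (g xs))"
  using recursive_fun.comp[of "[f, g]" "\<lambda>ys. h (ys ! 0) (ys ! 1)" k] assms
  by (auto simp: numeral_2_eq_2)

lemma recursive_Suc: "recursive_fun k f \<Longrightarrow> recursive_fun k (\<lambda>xs. Suc (f xs))"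
  by (rule recursive_comp1[OF recursive_fun.succ])

section \<open>Composition with projections and general primitive recursion\<close>

lemma recursive_reindex:
  assumes "recursive_fun (length is) h" "\<And>i. i \<in> set is \<Longrightarrow> i < k"
  shows "recursive_fun k (\<lambda>xs. h (map ((!) xs) is))"
  using recursive_fun.comp[of "map (\<lambda>i xs. xs ! i) is" h k] assms
  by (auto simp: comp_def intro: recursive_fun.proj)

lemma map_nth_shift: "length xs = m + k \<Longrightarrow> map ((!) xs) [m..<m + k] = drop m xs"
  by (intro nth_equalityI) auto

lemma recursive_drop:
  assumes "recursive_fun k h"
  shows "recursive_fun (m + k) (\<lambda>xs. h (drop m xs))"
  by (rule recursive_fun.ext[OF recursive_reindex[of "[m..<m + k]" h]])
    (use assms in \<open>auto simp: map_nth_shift\<close>)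

text \<open>The step of a primitive recursion receives the counter, the previous value and the
  parameters. This form serves for subterms of the step that ignore the previous value, which sits
  at position 1.\<close>

lemma recursive_skip:
  assumes "recursive_fun (Suc k) (\<lambda>ys. F (ys ! 0) (tl ys))"
  shows "recursive_fun (Suc (Suc k)) (\<lambda>ys. F (ys ! 0) (drop 2 ys))"
proof (rule recursive_fun.ext)
  let ?is = "0 # [2..<2 + k]"
  show "recursive_fun (Suc (Suc k)) (\<lambda>xs. (\<lambda>ys. F (ys ! 0) (tl ys)) (map ((!) xs) ?is))"
    by (rule recursive_reindex) (use assms in \<open>auto simp del: upt_Suc\<close>)
  show "F (xs ! 0) (drop 2 xs) = (\<lambda>ys. F (ys ! 0) (tl ys)) (map ((!) xs) ?is)"
    if "length xs = Suc (Suc k)" for xs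
    using that map_nth_shift[of xs 2 k] by (simp del: upt_Suc)
qed

text \<open>Composition with \<open>N\<close> followed by all \<open>k\<close> projections; it turns
  the depth of a recursion into a function of the parameters.\<close>

lemma recursive_substitute:
  assumes "recursive_fun (Suc k) (\<lambda>ys. F (hd ys) (tl ys))" "recursive_fun k N"
  shows "recursive_fun k (\<lambda>xs. F (N xs) xs)"
proof -
  let ?gs = "N # map (\<lambda>i xs. xs ! i) [0..<k]"
  have "recursive_fun k (\<lambda>xs. (\<lambda>ys. F (hd ys) (tl ys)) (map (\<lambda>g. g xs) ?gs))"
    by (rule recursive_fun.comp) (use assms in \<open>auto intro: recursive_fun.proj\<close>)
  then show ?thesis
    by (rule recursive_fun.ext) (auto simp: comp_def map_nth)
qed

lemma recursive_rec_nat: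
  assumes f: "recursive_fun k f"
    and G: "recursive_fun (Suc (Suc k)) (\<lambda>ys. G (ys ! 0) (ys ! 1) (drop 2 ys))"
    and N: "recursive_fun k N"
  shows "recursive_fun k (\<lambda>xs. rec_nat (f xs) (\<lambda>n r. G n r xs) (N xs))"
proof -
  have "recursive_fun (Suc k) (\<lambda>xs. rec_nat (f (tl xs)) (\<lambda>n r. G n r (tl xs)) (hd xs))"
    using recursive_fun.prec[OF f G] by simp
  then show ?thesis
    by (rule recursive_substitute[OF _ N])
qed

section \<open>Arithmetic operations\<close>

lemma recursive_add:
  assumes "recursive_fun k f" "recursive_fun k g"
  shows "recursive_fun k (\<lambda>xs. f xs + g xs)"
proof (rule recursive_fun.ext)
  show "recursive_fun k (\<lambda>xs. rec_nat (f xs) (\<lambda>n r. Suc r) (g xs))"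
    by (intro recursive_rec_nat recursive_Suc recursive_fun.proj assms) simp
  have "rec_nat x (\<lambda>n r. Suc r) m = x + m" for x m :: nat
    by (induction m) simp_all
  then show "f xs + g xs = rec_nat (f xs) (\<lambda>n r. Suc r) (g xs)" for xs
    by simp
qed

lemma recursive_drop2:
  "recursive_fun k f \<Longrightarrow> recursive_fun (Suc (Suc k)) (\<lambda>ys. f (drop 2 ys))"
  using recursive_drop[of k f 2] by simp

lemma recursive_mult:
  assumes "recursive_fun k f" "recursive_fun k g"
  shows "recursive_fun k (\<lambda>xs. f xs * g xs)"
proof (rule recursive_fun.ext)
  show "recursive_fun k (\<lambda>xs. rec_nat 0 (\<lambda>n r. r + f xs) (g xs))"
    by (intro recursive_rec_nat recursive_add recursive_drop2 recursive_fun.proj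
        recursive_const assms) simp
  have "rec_nat 0 (\<lambda>n r. r + x) m = x * m" for x m :: nat
    by (induction m) simp_all
  then show "f xs * g xs = rec_nat 0 (\<lambda>n r. r + f xs) (g xs)" for xs
    by simp
qed

lemma recursive_power:
  assumes "recursive_fun k f" "recursive_fun k g"
  shows "recursive_fun k (\<lambda>xs. f xs ^ g xs)"
proof (rule recursive_fun.ext)
  show "recursive_fun k (\<lambda>xs. rec_nat 1 (\<lambda>n r. r * f xs) (g xs))"
    by (intro recursive_rec_nat recursive_mult recursive_drop2 recursive_fun.proj
        recursive_const assms) simp
  have "rec_nat 1 (\<lambda>n r. r * x) m = x ^ m" for x m :: nat
    by (induction m) simp_all
  then show "f xs ^ g xs = rec_nat 1 (\<lambda>n r. r * f xs) (g xs)" for xs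
    by simp
qed

lemma recursive_pred:
  assumes "recursive_fun k f"
  shows "recursive_fun k (\<lambda>xs. f xs - 1)"
proof (rule recursive_fun.ext)
  show "recursive_fun k (\<lambda>xs. rec_nat 0 (\<lambda>n r. n) (f xs))"
    by (intro recursive_rec_nat recursive_fun.proj recursive_const assms) simp
  have "rec_nat 0 (\<lambda>n r. n) m = m - 1" for m :: nat
    by (cases m) simp_all
  then show "f xs - 1 = rec_nat 0 (\<lambda>n r. n) (f xs)" for xs
    by simp
qed

lemma recursive_diff:
  assumes "recursive_fun k f" "recursive_fun k g"
  shows "recursive_fun k (\<lambda>xs. f xs - g xs)"
proof (rule recursive_fun.ext)
  show "recursive_fun k (\<lambda>xs. rec_nat (f xs) (\<lambda>n r. r - 1) (g xs))"
    by (intro recursive_rec_nat recursive_pred recursive_fun.proj assms) simp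
  have "rec_nat x (\<lambda>n r. r - 1) m = x - m" for x m :: nat
    by (induction m) simp_all
  then show "f xs - g xs = rec_nat (f xs) (\<lambda>n r. r - 1) (g xs)" for xs
    by simp
qed

lemma recursive_triangle:
  assumes "recursive_fun k f"
  shows "recursive_fun k (\<lambda>xs. triangle (f xs))"
proof (rule recursive_fun.ext)
  show "recursive_fun k (\<lambda>xs. rec_nat 0 (\<lambda>n r. r + Suc n) (f xs))"
    by (intro recursive_rec_nat recursive_add recursive_Suc recursive_fun.proj
        recursive_const assms) simp_all
  have "rec_nat 0 (\<lambda>n r. r + Suc n) m = triangle m" for m
    by (induction m) simp_all
  then show "triangle (f xs) = rec_nat 0 (\<lambda>n r. r + Suc n) (f xs)" for xs
    by simp
qed

section \<open>The pairing function and its inverses\<close>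

lemma recursive_prod_encode:
  assumes "recursive_fun k f" "recursive_fun k g"
  shows "recursive_fun k (\<lambda>xs. prod_encode (f xs, g xs))"
  unfolding prod_encode_def by (simp, intro recursive_add recursive_triangle assms)

text \<open>\<open>z\<close> lies on the diagonal \<open>m + n = s\<close> for the least \<open>s\<close> with \<open>z < triangle (Suc s)\<close>.\<close>

lemma prod_decode_Least:
  defines "diag \<equiv> \<lambda>z. LEAST s. Suc z - triangle (Suc s) = 0"
  shows "fst (prod_decode z) = z - triangle (diag z)"
    and "snd (prod_decode z) = diag z - (z - triangle (diag z))"
proof -
  obtain m n where mn: "prod_decode z = (m, n)" by fastforce
  then have z: "z = triangle (m + n) + m"
    using prod_decode_inverse[of z] by (simp add: prod_encode_def)
  have mono: "triangle s \<le> triangle t" if "s \<le> t" for s t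
    using that unfolding triangle_def by (intro div_le_mono mult_le_mono) auto
  have "diag z = m + n"
    unfolding diag_def
  proof (rule Least_equality)
    show "Suc z - triangle (Suc (m + n)) = 0"
      by (simp add: z)
    fix s assume s: "Suc z - triangle (Suc s) = 0"
    show "m + n \<le> s"
    proof (rule ccontr)
      assume "\<not> m + n \<le> s"
      then have "triangle (Suc s) \<le> triangle (m + n)" by (intro mono) simp
      with s show False by (simp add: z del: triangle_Suc)
    qed
  qed
  then show "fst (prod_decode z) = z - triangle (diag z)"
    "snd (prod_decode z) = diag z - (z - triangle (diag z))"
    unfolding mn by (simp_all add: z)
qed

lemma recursive_diagonal:
  assumes "recursive_fun k f"
  shows "recursive_fun k (\<lambda>xs. LEAST s. Suc (f xs) - triangle (Suc s) = 0)"
proof -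
  have "recursive_fun (Suc 1) (\<lambda>ys. Suc (ys ! 1) - triangle (Suc (ys ! 0)))"
    by (intro recursive_diff recursive_Suc recursive_triangle recursive_fun.proj) simp_all
  then have "recursive_fun 1 (\<lambda>xs. LEAST s. Suc ((s # xs) ! 1) - triangle (Suc ((s # xs) ! 0)) = 0)"
  proof (rule recursive_fun.minim)
    fix xs :: "nat list"
    \<comment> \<open>\<open>triangle (Suc z)\<close> is at least \<open>Suc z\<close>, so
      \<open>z\<close> itself is a witness and the minimization is regular.\<close>
    have "Suc (xs ! 0) - triangle (Suc (xs ! 0)) = 0" by simp
    then show "\<exists>s. Suc ((s # xs) ! 1) - triangle (Suc ((s # xs) ! 0)) = 0"
      by (intro exI[of _ "xs ! 0"]) simp
  qed
  then have "recursive_fun 1 (\<lambda>xs. LEAST s. Suc (xs ! 0) - triangle (Suc s) = 0)"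
    by simp
  then show ?thesis
    using assms by (rule recursive_comp1)
qed

lemma recursive_fst_prod_decode:
  "recursive_fun k f \<Longrightarrow> recursive_fun k (\<lambda>xs. fst (prod_decode (f xs)))"
  unfolding prod_decode_Least
  by (intro recursive_diff recursive_triangle recursive_diagonal)

lemma recursive_snd_prod_decode:
  "recursive_fun k f \<Longrightarrow> recursive_fun k (\<lambda>xs. snd (prod_decode (f xs)))"
  unfolding prod_decode_Least
  by (intro recursive_diff recursive_triangle recursive_diagonal)

section \<open>Boolean operations, bounded quantifiers and primality\<close>

lemma recursive_rel_not:
  assumes "recursive_rel k P"
  shows "recursive_rel k (\<lambda>xs. \<not> P xs)"
  unfolding recursive_rel_def
  by (rule recursive_fun.ext[OF recursive_diff[OF recursive_const[of k 1] assms[unfolded recursive_rel_def]]]) auto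

lemma recursive_rel_conj:
  assumes "recursive_rel k P" "recursive_rel k Q"
  shows "recursive_rel k (\<lambda>xs. P xs \<and> Q xs)"
  using recursive_mult[OF assms[unfolded recursive_rel_def]]
  by (simp add: recursive_rel_def of_bool_conj)

text \<open>With truncated subtraction, \<open>f xs < g xs\<close> holds iff
  \<open>Suc (f xs) - g xs\<close> is \<open>0\<close>; subtracting this from \<open>1\<close> gives
  the truth value.\<close>

lemma recursive_rel_less:
  assumes "recursive_fun k f" "recursive_fun k g"
  shows "recursive_rel k (\<lambda>xs. f xs < g xs)"
  unfolding recursive_rel_def
  by (rule recursive_fun.ext[OF recursive_diff[OF recursive_const[of k 1]
          recursive_diff[OF recursive_Suc[OF assms(1)] assms(2)]]]) auto

lemma recursive_rel_eq:
  assumes "recursive_fun k f" "recursive_fun k g"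
  shows "recursive_rel k (\<lambda>xs. f xs = g xs)"
proof -
  have "recursive_rel k (\<lambda>xs. \<not> f xs < g xs \<and> \<not> g xs < f xs)"
    by (intro recursive_rel_conj recursive_rel_not recursive_rel_less assms)
  then show ?thesis
    by (simp add: nat_neq_iff[symmetric] flip: de_Morgan_disj)
qed

lemma recursive_rel_mem:
  assumes "recursive_set A" "recursive_fun k f"
  shows "recursive_rel k (\<lambda>xs. f xs \<in> A)"
  using recursive_comp1[of "\<lambda>n. of_bool (n \<in> A)" k f] assms
  by (simp add: recursive_set_def recursive_rel_def)

text \<open>The truth value of a bounded quantifier is the product of the truth values below the
  bound.\<close>

lemma recursive_rel_ball:
  assumes "recursive_rel (Suc k) (\<lambda>ys. P (ys ! 0) (tl ys))" "recursive_fun k N"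
  shows "recursive_rel k (\<lambda>xs. \<forall>i<N xs. P i xs)"
  unfolding recursive_rel_def
proof (rule recursive_fun.ext)
  show "recursive_fun k (\<lambda>xs. rec_nat 1 (\<lambda>i r. r * of_bool (P i xs)) (N xs))"
    by (intro recursive_rec_nat recursive_mult recursive_const recursive_fun.proj assms(2)
        recursive_skip[of _ "\<lambda>i xs. of_bool (P i xs)"] assms(1)[unfolded recursive_rel_def]) simp
  have "rec_nat 1 (\<lambda>i r. r * of_bool (P i xs)) m = (of_bool (\<forall>i<m. P i xs) :: nat)" for m xs
    by (induction m) (auto simp: less_Suc_eq)
  then show "(of_bool (\<forall>i<N xs. P i xs) :: nat) = rec_nat 1 (\<lambda>i r. r * of_bool (P i xs)) (N xs)"
    for xs
    by (rule sym)
qed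

text \<open>Divisibility is replaced by quantifiers bounded by \<open>p\<close> itself, the form
  that \<open>recursive_rel_ball\<close> handles. In a factorization of \<open>p > 1\<close> both
  factors are at most \<open>p\<close>, and if one equals \<open>p\<close>, the other is
  \<open>1\<close>.\<close>

lemma prime_iff_no_proper_product:
  "Factorial_Ring.prime (p :: nat) \<longleftrightarrow> 1 < p \<and> (\<forall>x<p. \<forall>y<p. x * y \<noteq> p)"
proof
  assume p: "Factorial_Ring.prime p"
  then show "1 < p \<and> (\<forall>x<p. \<forall>y<p. x * y \<noteq> p)"
    by (metis dvd_triv_left less_irrefl mult_1 prime_nat_iff)
next
  assume p: "1 < p \<and> (\<forall>x<p. \<forall>y<p. x * y \<noteq> p)"
  have "m = 1 \<or> m = p" if "m dvd p" for m
  proof -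
    obtain q where q: "p = m * q" using \<open>m dvd p\<close> ..
    with p have "0 < p" "m \<noteq> 0" "q \<noteq> 0" by (auto intro: Nat.gr0I)
    then have "m \<le> p" "q \<le> p" by (auto simp: q)
    with p q have "m = p \<or> q = p" by (metis le_neq_implies_less)
    then show ?thesis using p q by auto
  qed
  with p show "Factorial_Ring.prime p"
    by (simp add: prime_nat_iff)
qed

lemma recursive_rel_prime:
  assumes "recursive_fun k f"
  shows "recursive_rel k (\<lambda>xs. Factorial_Ring.prime (f xs))"
proof -
  have f1: "recursive_fun (Suc k) (\<lambda>ys. f (tl ys))"
    using recursive_drop[OF assms, of 1] by (simp add: drop_Suc)
  have f2: "recursive_fun (Suc (Suc k)) (\<lambda>ys. f (tl (tl ys)))"
    using recursive_drop[OF f1, of 1] by (simp add: drop_Suc)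
  \<comment> \<open>Each quantifier puts its variable in front: \<open>zs ! 0\<close> is
    \<open>y\<close>, \<open>tl zs ! 0\<close> is \<open>x\<close>, and the parameters start at
    position 2.\<close>
  have "recursive_rel (Suc (Suc k)) (\<lambda>zs. tl zs ! 0 * zs ! 0 \<noteq> f (tl (tl zs)))"
  proof -
    have "recursive_fun (Suc (Suc k)) (\<lambda>zs. tl zs ! 0)"
      by (rule recursive_fun.ext[OF recursive_fun.proj[of 1]]) (auto simp: nth_tl)
    then show ?thesis
      by (intro recursive_rel_not recursive_rel_eq recursive_mult f2 recursive_fun.proj) simp_all
  qed
  then show ?thesis
    unfolding prime_iff_no_proper_product
    by (intro recursive_rel_conj recursive_rel_less recursive_rel_ball recursive_const assms f1)
qed

section \<open>Sentences describing finite modules\<close>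

lemma code_tm_inject: "code_tm s = code_tm t \<Longrightarrow> s = t"
proof (induction s arbitrary: t)
  case (Var i) then show ?case by (cases t) auto
next
  case Zero then show ?case by (cases t) auto
next
  case (Plus s1 s2) then show ?case by (cases t) auto
next
  case (Scal r s) then show ?case by (cases t) auto
qed

text \<open>The decidability hypothesis concerns a set of codes; injectivity lets membership of a
  code be read back as membership of its formula.\<close>

lemma code_fm_inject: "code_fm \<phi> = code_fm \<psi> \<Longrightarrow> \<phi> = \<psi>"
proof (induction \<phi> arbitrary: \<psi>)
  case (Eq s t) then show ?case by (cases \<psi>) (auto dest: code_tm_inject)
next
  case (Neg \<phi>) then show ?case by (cases \<psi>) auto
next
  case (Conj \<phi>1 \<phi>2) then show ?case by (cases \<psi>) auto
next
  case (Ex i \<phi>) then show ?case by (cases \<psi>) auto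
qed

section \<open>First-order expression of finite cardinality, injectivity and annihilation\<close>

primrec big_conj :: "(nat \<Rightarrow> 'r fm) \<Rightarrow> nat \<Rightarrow> 'r fm" where
  "big_conj f 0 = Eq Zero Zero"
| "big_conj f (Suc n) = Conj (big_conj f n) (f n)"

primrec exs :: "nat \<Rightarrow> 'r fm \<Rightarrow> 'r fm" where
  "exs 0 \<phi> = \<phi>"
| "exs (Suc n) \<phi> = Ex n (exs n \<phi>)"

definition distinct_fm :: "nat \<Rightarrow> nat \<Rightarrow> 'r fm" where
  "distinct_fm n j = big_conj (\<lambda>i. Neg (Eq (Var i) (Var j))) n"

text \<open>\<open>distinct_fm\<close> serves twice: positively, for every \<open>j < n\<close>, it
  makes the listed elements pairwise distinct; negatively, with the fresh variable \<open>n\<close>,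
  it rules out a further element.\<close>

definition card_fm :: "nat \<Rightarrow> 'r fm" where
  "card_fm n = exs n (Conj (big_conj (\<lambda>j. distinct_fm j j) n) (Neg (Ex n (distinct_fm n n))))"

definition inj_fm :: "'r \<Rightarrow> 'r fm" where
  "inj_fm r = Neg (Ex 0 (Conj (Eq (Scal r (Var 0)) Zero) (Neg (Eq (Var 0) Zero))))"

definition ann_fm :: "'r \<Rightarrow> 'r fm" where
  "ann_fm r = Neg (Ex 0 (Neg (Eq (Scal r (Var 0)) Zero)))"

definition module_fm :: "nat \<Rightarrow> 'r \<Rightarrow> nat \<Rightarrow> (nat \<Rightarrow> 'r) \<Rightarrow> 'r fm" where
  "module_fm N d m c = Conj (card_fm N) (Conj (inj_fm d) (big_conj (\<lambda>i. ann_fm (c i)) m))"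

lemma sat_big_conj: "sat M v (big_conj f n) \<longleftrightarrow> (\<forall>i<n. sat M v (f i))"
  by (induction n) (auto simp: less_Suc_eq)

text \<open>\<open>Ex n\<close> is outermost and the inner block binds only variables below
  \<open>n\<close>, so the value \<open>x\<close> chosen for \<open>n\<close> survives and joins the
  block as \<open>w(n := x)\<close>.\<close>

lemma sat_exs:
  "sat M v (exs n \<phi>) \<longleftrightarrow>
    (\<exists>w. w ` {..<n} \<subseteq> carrier M \<and> sat M (\<lambda>i. if i < n then w i else v i) \<phi>)"
proof (induction n arbitrary: v)
  case (Suc n)
  have "sat M v (exs (Suc n) \<phi>) \<longleftrightarrow>
    (\<exists>x\<in>carrier M. \<exists>w. w ` {..<n} \<subseteq> carrier M \<and>
      sat M (\<lambda>i. if i < n then w i else (v(n := x)) i) \<phi>)"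
    by (simp add: Suc)
  also have "\<dots> \<longleftrightarrow> (\<exists>w. w ` {..<Suc n} \<subseteq> carrier M \<and> sat M (\<lambda>i. if i < Suc n then w i else v i) \<phi>)"
  proof safe
    fix x w assume "x \<in> carrier M" "w ` {..<n} \<subseteq> carrier M"
      and *: "sat M (\<lambda>i. if i < n then w i else (v(n := x)) i) \<phi>"
    moreover have "(\<lambda>i. if i < n then w i else (v(n := x)) i) =
        (\<lambda>i. if i < Suc n then (w(n := x)) i else v i)"
      by auto
    ultimately show "\<exists>w. w ` {..<Suc n} \<subseteq> carrier M \<and>
        sat M (\<lambda>i. if i < Suc n then w i else v i) \<phi>"
      by (intro exI[of _ "w(n := x)"]) (auto simp: less_Suc_eq)
  next
    fix w assume "w ` {..<Suc n} \<subseteq> carrier M" and "sat M (\<lambda>i. if i < Suc n then w i else v i) \<phi>"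
    moreover have "(\<lambda>i. if i < Suc n then w i else v i) =
        (\<lambda>i. if i < n then w i else (v(n := w n)) i)"
      by auto
    ultimately show "\<exists>x\<in>carrier M. \<exists>w. w ` {..<n} \<subseteq> carrier M \<and>
        sat M (\<lambda>i. if i < n then w i else (v(n := x)) i) \<phi>"
      by (intro bexI[of _ "w n"] exI[of _ w]) auto
  qed
  finally show ?case .
qed simp

lemma sat_distinct_fm: "sat M v (distinct_fm n j) \<longleftrightarrow> (\<forall>i<n. v i \<noteq> v j)"
  by (simp add: distinct_fm_def sat_big_conj)

text \<open>The three conjuncts are what the outer quantifiers, the distinctness conditions and the
  negated part of \<open>card_fm\<close> express.\<close>

lemma bij_betw_lessThan_iff:
  fixes w :: "nat \<Rightarrow> 'b"
  shows "bij_betw w {..<n} A \<longleftrightarrow>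
    w ` {..<n} \<subseteq> A \<and> (\<forall>j<n. \<forall>i<j. w i \<noteq> w j) \<and> (\<forall>x\<in>A. \<exists>i<n. w i = x)"
proof
  assume "bij_betw w {..<n} A"
  then show "w ` {..<n} \<subseteq> A \<and> (\<forall>j<n. \<forall>i<j. w i \<noteq> w j) \<and> (\<forall>x\<in>A. \<exists>i<n. w i = x)"
    by (auto simp: bij_betw_def inj_on_def)
next
  assume *: "w ` {..<n} \<subseteq> A \<and> (\<forall>j<n. \<forall>i<j. w i \<noteq> w j) \<and> (\<forall>x\<in>A. \<exists>i<n. w i = x)"
  then have "inj_on w {..<n}"
    by (intro linorder_inj_onI) auto
  with * show "bij_betw w {..<n} A"
    by (auto simp: bij_betw_def)
qed

text \<open>Since \<open>card\<close> is \<open>0\<close> on infinite sets, it is the positivity of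
  \<open>n\<close> that makes the equation force a finite carrier, which can then be
  enumerated.\<close>

lemma sat_card_fm:
  assumes "n > 0"
  shows "sat M v (card_fm n) \<longleftrightarrow> card (carrier M) = n"
proof -
  have "sat M v (card_fm n) \<longleftrightarrow> (\<exists>w. bij_betw w {..<n} (carrier M))"
    unfolding card_fm_def sat_exs bij_betw_lessThan_iff
    by (simp add: sat_big_conj sat_distinct_fm)
  also have "\<dots> \<longleftrightarrow> card (carrier M) = n"
  proof
    assume n: "card (carrier M) = n"
    with assms have "finite (carrier M)" by (intro card_ge_0_finite) simp
    then show "\<exists>w. bij_betw w {..<n} (carrier M)"
      using ex_bij_betw_nat_finite[of "carrier M"] n by (simp add: lessThan_atLeast0)
  qed (auto dest: bij_betw_same_card)
  finally show ?thesis .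
qed

lemma sat_module_fm:
  assumes "N > 0"
  shows "sat M v (module_fm N d m c) \<longleftrightarrow> card (carrier M) = N \<and>
    (\<forall>x\<in>carrier M. d \<odot>\<^bsub>M\<^esub> x = \<zero>\<^bsub>M\<^esub> \<longrightarrow> x = \<zero>\<^bsub>M\<^esub>) \<and>
    (\<forall>i<m. \<forall>x\<in>carrier M. c i \<odot>\<^bsub>M\<^esub> x = \<zero>\<^bsub>M\<^esub>)"
  using sat_card_fm[OF assms, of M v]
  by (auto simp: module_fm_def inj_fm_def ann_fm_def sat_big_conj)

section \<open>Free variables, coefficients and renaming of coefficients\<close>

lemma fv_big_conj: "fv (big_conj f n) = (\<Union>i<n. fv (f i))"
  by (induction n) (auto simp: lessThan_Suc)

lemma fv_exs: "fv (exs n \<phi>) = fv \<phi> - {..<n}"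
  by (induction n) (auto simp: lessThan_Suc)

lemma fv_module_fm: "fv (module_fm N d m c) = {}"
  by (auto simp: module_fm_def card_fm_def distinct_fm_def inj_fm_def ann_fm_def fv_big_conj fv_exs)

lemma coeffs_big_conj: "coeffs_fm (big_conj f n) = (\<Union>i<n. coeffs_fm (f i))"
  by (induction n) (auto simp: lessThan_Suc)

lemma coeffs_exs: "coeffs_fm (exs n \<phi>) = coeffs_fm \<phi>"
  by (induction n) auto

lemma coeffs_module_fm: "coeffs_fm (module_fm N d m c) = insert d (c ` {..<m})"
  by (auto simp: module_fm_def card_fm_def distinct_fm_def inj_fm_def ann_fm_def
      coeffs_big_conj coeffs_exs)

lemma map_big_conj: "map_fm a (big_conj f n) = big_conj (\<lambda>i. map_fm a (f i)) n"
  by (induction n) auto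

lemma map_exs: "map_fm a (exs n \<phi>) = exs n (map_fm a \<phi>)"
  by (induction n) auto

lemma map_module_fm: "map_fm a (module_fm N d m c) = module_fm N (a d) m (\<lambda>i. a (c i))"
  by (simp add: module_fm_def card_fm_def distinct_fm_def inj_fm_def ann_fm_def
      map_big_conj map_exs)

section \<open>Recursiveness of the codes of the sentences\<close>

lemma recursive_big_conj:
  assumes "recursive_fun (Suc k) (\<lambda>ys. code_fm (F (tl ys) (ys ! 0)))" "recursive_fun k N"
  shows "recursive_fun k (\<lambda>xs. code_fm (big_conj (F xs) (N xs)))"
proof (rule recursive_fun.ext)
  \<comment> \<open>This repeats the clause of \<open>code_fm\<close> for \<open>Conj\<close>, whose
    tag is \<open>2\<close>; the previous value \<open>r\<close> is the code of the conjunction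
    built so far.\<close>
  let ?G = "\<lambda>i r xs. prod_encode (2, prod_encode (r, code_fm (F xs i)))"
  show "recursive_fun k (\<lambda>xs. rec_nat (code_fm (Eq Zero Zero :: nat fm)) (\<lambda>i r. ?G i r xs) (N xs))"
    by (intro recursive_rec_nat recursive_prod_encode recursive_const recursive_fun.proj assms(2)
        recursive_skip[of _ "\<lambda>i xs. code_fm (F xs i)"] assms(1)) simp
  have "code_fm (big_conj (F xs) m) = rec_nat (code_fm (Eq Zero Zero :: nat fm)) (\<lambda>i r. ?G i r xs) m"
    for m xs
    by (induction m) simp_all
  then show "code_fm (big_conj (F xs) (N xs)) =
      rec_nat (code_fm (Eq Zero Zero :: nat fm)) (\<lambda>i r. ?G i r xs) (N xs)" for xs
    by simp
qed

lemma recursive_exs: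
  assumes "recursive_fun k (\<lambda>xs. code_fm (F xs))" "recursive_fun k N"
  shows "recursive_fun k (\<lambda>xs. code_fm (exs (N xs) (F xs)))"
proof (rule recursive_fun.ext)
  let ?G = "\<lambda>i r. prod_encode (3, prod_encode (i, r))"
  show "recursive_fun k (\<lambda>xs. rec_nat (code_fm (F xs)) (\<lambda>i r. ?G i r) (N xs))"
    by (intro recursive_rec_nat recursive_prod_encode recursive_const recursive_fun.proj assms) simp_all
  have "code_fm (exs m (F xs)) = rec_nat (code_fm (F xs)) (\<lambda>i r. ?G i r) m" for m xs
    by (induction m) simp_all
  then show "code_fm (exs (N xs) (F xs)) = rec_nat (code_fm (F xs)) (\<lambda>i r. ?G i r) (N xs)" for xs
    by simp
qed

lemma recursive_distinct_fm:
  assumes "recursive_fun k f" "recursive_fun k g"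
  shows "recursive_fun k (\<lambda>xs. code_fm (distinct_fm (f xs) (g xs)))"
proof -
  have "recursive_fun 2 (\<lambda>xs. code_fm (big_conj (\<lambda>i. Neg (Eq (Var i) (Var (xs ! 1)))) (xs ! 0)))"
  proof (rule recursive_big_conj)
    \<comment> \<open>The index bound by the conjunction is put in front, so \<open>j\<close>, at
      position 1 of the parameters, moves to position 2.\<close>
    have "recursive_fun (Suc 2) (\<lambda>ys. tl ys ! 1)"
      by (rule recursive_fun.ext[OF recursive_fun.proj[of 2]]) (auto simp: nth_tl numeral_2_eq_2)
    then show "recursive_fun (Suc 2) (\<lambda>ys. code_fm (Neg (Eq (Var (ys ! 0)) (Var (tl ys ! 1)))))"
      by (simp, intro recursive_prod_encode recursive_const recursive_fun.proj) simp_all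
  qed (intro recursive_fun.proj, simp)
  then have "recursive_fun 2 (\<lambda>xs. code_fm (distinct_fm (xs ! 0) (xs ! 1)))"
    by (simp add: distinct_fm_def)
  then show ?thesis
    by (rule recursive_comp2) (rule assms)+
qed

lemma recursive_card_fm:
  assumes "recursive_fun k f"
  shows "recursive_fun k (\<lambda>xs. code_fm (card_fm (f xs)))"
proof -
  have "recursive_fun k (\<lambda>xs. code_fm (big_conj (\<lambda>j. distinct_fm j j) (f xs)))"
    by (intro recursive_big_conj recursive_distinct_fm recursive_fun.proj assms) simp_all
  then have "recursive_fun k (\<lambda>xs. code_fm (Conj (big_conj (\<lambda>j. distinct_fm j j) (f xs))
      (Neg (Ex (f xs) (distinct_fm (f xs) (f xs))))))"
    by (simp, intro recursive_prod_encode recursive_const recursive_distinct_fm assms) simp_all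
  then show ?thesis
    unfolding card_fm_def by (rule recursive_exs) (rule assms)
qed

lemma recursive_module_fm:
  assumes "recursive_fun k f" "recursive_fun k g" "recursive_fun k h"
    and "recursive_fun (Suc k) (\<lambda>ys. c (tl ys) (ys ! 0))"
  shows "recursive_fun k (\<lambda>xs. code_fm (module_fm (f xs) (g xs) (h xs) (c xs)))"
proof -
  have "recursive_fun k (\<lambda>xs. code_fm (big_conj (\<lambda>i. ann_fm (c xs i)) (h xs)))"
    unfolding ann_fm_def
    by (rule recursive_big_conj[OF _ assms(3)], simp)
      (intro recursive_prod_encode recursive_const assms(4))
  then show ?thesis
    unfolding module_fm_def inj_fm_def
    by (simp, intro recursive_prod_encode recursive_const recursive_card_fm assms)
qed

section \<open>Access to coded lists\<close>

definition code_hd :: "nat \<Rightarrow> nat" where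
  "code_hd x = fst (prod_decode (x - 1))"

definition code_tl :: "nat \<Rightarrow> nat" where
  "code_tl x = snd (prod_decode (x - 1))"

text \<open>The code of a nonempty list is the successor of a pair, hence the \<open>x - 1\<close>
  in \<open>code_hd\<close> and \<open>code_tl\<close>. For the empty list truncation leads to
  \<open>prod_decode 0\<close>, so its head reads as \<open>0\<close> and its tail is again
  empty.\<close>

lemma prod_decode_0: "prod_decode 0 = (0, 0)"
  by (simp add: prod_decode_def prod_decode_aux.simps)

lemma code_hd_encode: "code_hd (list_encode xs) = (if xs = [] then 0 else hd xs)"
  by (cases xs) (simp_all add: code_hd_def prod_decode_0)

lemma code_tl_encode: "code_tl (list_encode xs) = list_encode (tl xs)"
  by (cases xs) (simp_all add: code_tl_def prod_decode_0)

lemma code_drop_encode: "(code_tl ^^ i) (list_encode xs) = list_encode (drop i xs)"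
  by (induction i) (simp_all add: code_tl_encode drop_Suc tl_drop)

lemma code_nth_encode:
  "code_hd ((code_tl ^^ i) (list_encode xs)) = (if i < length xs then xs ! i else 0)"
  by (simp add: code_drop_encode code_hd_encode hd_drop_conv_nth)

lemma length_le_list_encode: "length xs \<le> list_encode xs"
proof (induction xs)
  case (Cons x xs)
  then show ?case using le_prod_encode_2[of "list_encode xs" x] by simp
qed simp

lemma recursive_code_hd: "recursive_fun k f \<Longrightarrow> recursive_fun k (\<lambda>xs. code_hd (f xs))"
  unfolding code_hd_def by (intro recursive_fst_prod_decode recursive_pred)

lemma recursive_code_tl: "recursive_fun k f \<Longrightarrow> recursive_fun k (\<lambda>xs. code_tl (f xs))"
  unfolding code_tl_def by (intro recursive_snd_prod_decode recursive_pred)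

lemma recursive_code_drop:
  assumes "recursive_fun k f" "recursive_fun k g"
  shows "recursive_fun k (\<lambda>xs. (code_tl ^^ f xs) (g xs))"
proof (rule recursive_fun.ext)
  show "recursive_fun k (\<lambda>xs. rec_nat (g xs) (\<lambda>n r. code_tl r) (f xs))"
    by (intro recursive_rec_nat recursive_code_tl recursive_fun.proj assms) simp
  have "rec_nat x (\<lambda>n r. code_tl r) m = (code_tl ^^ m) x" for x m
    by (induction m) simp_all
  then show "(code_tl ^^ f xs) (g xs) = rec_nat (g xs) (\<lambda>n r. code_tl r) (f xs)" for xs
    by simp
qed

section \<open>Finite modules and residue fields\<close>

definition residue_module :: "('r, 'b) ring_scheme \<Rightarrow> 'r set \<Rightarrow> ('r, 'r set) module" where
  "residue_module R I =
    \<lparr>carrier = carrier (R Quot I), mult = mult (R Quot I), one = one (R Quot I),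
     zero = zero (R Quot I), add = add (R Quot I),
     smult = \<lambda>r X. (I +>\<^bsub>R\<^esub> r) \<otimes>\<^bsub>R Quot I\<^esub> X\<rparr>"

lemma module_residue_module:
  assumes "cring R" "ideal I R"
  shows "module R (residue_module R I)"
proof -
  interpret R: cring R by fact
  interpret I: ideal I R by fact
  interpret Q: cring "R Quot I" by (rule I.quotient_is_cring) fact
  interpret h: ring_hom_ring R "R Quot I" "(+>\<^bsub>R\<^esub>) I" by (rule I.rcos_ring_hom_ring)
  show ?thesis
  proof (rule moduleI)
    show "abelian_group (residue_module R I)"
      by (rule abelian_groupI)
        (auto simp: residue_module_def Q.a_ac intro: Q.add.l_inv_ex)
  qed (auto simp: residue_module_def assms Q.l_distr Q.r_distr Q.m_assoc)
qed

text \<open>Extensional functions represent each family exactly once: equality can be checked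
  componentwise and, for finite \<open>I\<close>, cardinalities multiply.\<close>

definition product_module :: "'i set \<Rightarrow> ('i \<Rightarrow> ('r, 'm, 'z) module_scheme) \<Rightarrow> ('r, 'i \<Rightarrow> 'm) module"
  where
  "product_module I M =
    \<lparr>carrier = (\<Pi>\<^sub>E i\<in>I. carrier (M i)), mult = undefined, one = undefined,
     zero = (\<lambda>i\<in>I. \<zero>\<^bsub>M i\<^esub>), add = (\<lambda>f g. \<lambda>i\<in>I. f i \<oplus>\<^bsub>M i\<^esub> g i),
     smult = (\<lambda>r f. \<lambda>i\<in>I. r \<odot>\<^bsub>M i\<^esub> f i)\<rparr>"

lemma product_module_ext:
  assumes "f \<in> carrier (product_module I M)" "g \<in> carrier (product_module I M)"
    and "\<And>i. i \<in> I \<Longrightarrow> f i = g i"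
  shows "f = g"
  by (rule PiE_ext[of f I "\<lambda>i. carrier (M i)"])
    (use assms in \<open>simp_all add: product_module_def\<close>)

lemma module_product_module:
  assumes R: "cring R" and M: "\<And>i. i \<in> I \<Longrightarrow> module R (M i)"
  shows "module R (product_module I M)"
proof -
  have ag: "abelian_group (M i)" if "i \<in> I" for i
    using M[OF that] by (rule module.axioms)
  then have am: "abelian_monoid (M i)" if "i \<in> I" for i
    using that by (auto simp: abelian_group_def)
  have mem: "f i \<in> carrier (M i)" if "f \<in> carrier (product_module I M)" "i \<in> I" for f i
    using that by (auto simp: product_module_def)
  note ext = product_module_ext[of _ I M]
  have add: "f \<oplus>\<^bsub>product_module I M\<^esub> g \<in> carrier (product_module I M)"
    if "f \<in> carrier (product_module I M)" "g \<in> carrier (product_module I M)" for f g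
    using that by (auto simp: product_module_def intro!: abelian_monoid.a_closed[OF am])
  have smult: "r \<odot>\<^bsub>product_module I M\<^esub> f \<in> carrier (product_module I M)"
    if "r \<in> carrier R" "f \<in> carrier (product_module I M)" for f r
    using that by (auto simp: product_module_def intro!: module.smult_closed[OF M])
  have zero: "\<zero>\<^bsub>product_module I M\<^esub> \<in> carrier (product_module I M)"
    by (auto simp: product_module_def intro!: abelian_monoid.zero_closed[OF am])
  have add_nth: "(f \<oplus>\<^bsub>product_module I M\<^esub> g) i = f i \<oplus>\<^bsub>M i\<^esub> g i" if "i \<in> I" for f g i
    using that by (simp add: product_module_def)
  have smult_nth: "(r \<odot>\<^bsub>product_module I M\<^esub> f) i = r \<odot>\<^bsub>M i\<^esub> f i" if "i \<in> I" for f r i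
    using that by (simp add: product_module_def)
  have zero_nth: "\<zero>\<^bsub>product_module I M\<^esub> i = \<zero>\<^bsub>M i\<^esub>" if "i \<in> I" for i
    using that by (simp add: product_module_def)
  note nth = add_nth smult_nth zero_nth
  have inverse: "\<exists>g\<in>carrier (product_module I M). g \<oplus>\<^bsub>product_module I M\<^esub> f = \<zero>\<^bsub>product_module I M\<^esub>"
    if f: "f \<in> carrier (product_module I M)" for f
  proof
    show g: "(\<lambda>i\<in>I. \<ominus>\<^bsub>M i\<^esub> f i) \<in> carrier (product_module I M)"
      using mem[OF f] by (auto simp: product_module_def intro!: abelian_group.a_inv_closed[OF ag])
    show "(\<lambda>i\<in>I. \<ominus>\<^bsub>M i\<^esub> f i) \<oplus>\<^bsub>product_module I M\<^esub> f = \<zero>\<^bsub>product_module I M\<^esub>"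
      by (rule ext[OF add[OF g f] zero]) (simp add: nth abelian_group.l_neg[OF ag] mem[OF f])
  qed
  show ?thesis
  proof (rule moduleI[OF R _ smult])
    show "abelian_group (product_module I M)"
    proof (rule abelian_groupI[OF add zero _ _ _ inverse])
      fix f g h assume fgh: "f \<in> carrier (product_module I M)" "g \<in> carrier (product_module I M)"
        "h \<in> carrier (product_module I M)"
      show "f \<oplus>\<^bsub>product_module I M\<^esub> g \<oplus>\<^bsub>product_module I M\<^esub> h =
          f \<oplus>\<^bsub>product_module I M\<^esub> (g \<oplus>\<^bsub>product_module I M\<^esub> h)"
        by (rule ext) (simp_all add: add fgh nth abelian_monoid.a_assoc[OF am] mem)
    next
      fix f g assume fg: "f \<in> carrier (product_module I M)" "g \<in> carrier (product_module I M)"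
      show "f \<oplus>\<^bsub>product_module I M\<^esub> g = g \<oplus>\<^bsub>product_module I M\<^esub> f"
        by (rule ext) (simp_all add: add fg nth abelian_monoid.a_comm[OF am] mem)
    next
      fix f assume f: "f \<in> carrier (product_module I M)"
      show "\<zero>\<^bsub>product_module I M\<^esub> \<oplus>\<^bsub>product_module I M\<^esub> f = f"
        by (rule ext) (simp_all add: add zero f nth abelian_monoid.l_zero[OF am] mem)
    qed
  next
    fix r s f assume rsf: "r \<in> carrier R" "s \<in> carrier R" "f \<in> carrier (product_module I M)"
    have rs: "r \<oplus>\<^bsub>R\<^esub> s \<in> carrier R" "r \<otimes>\<^bsub>R\<^esub> s \<in> carrier R"
      using R rsf by (simp_all add: cring.cring_simprules)
    show "(r \<oplus>\<^bsub>R\<^esub> s) \<odot>\<^bsub>product_module I M\<^esub> f =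
        r \<odot>\<^bsub>product_module I M\<^esub> f \<oplus>\<^bsub>product_module I M\<^esub> s \<odot>\<^bsub>product_module I M\<^esub> f"
      by (rule ext) (simp_all add: add smult rs rsf nth module.smult_l_distr[OF M] mem)
    show "(r \<otimes>\<^bsub>R\<^esub> s) \<odot>\<^bsub>product_module I M\<^esub> f =
        r \<odot>\<^bsub>product_module I M\<^esub> (s \<odot>\<^bsub>product_module I M\<^esub> f)"
      by (rule ext) (simp_all add: smult rs rsf nth module.smult_assoc1[OF M] mem)
  next
    fix r f g assume rfg: "r \<in> carrier R" "f \<in> carrier (product_module I M)"
      "g \<in> carrier (product_module I M)"
    show "r \<odot>\<^bsub>product_module I M\<^esub> (f \<oplus>\<^bsub>product_module I M\<^esub> g) =
        r \<odot>\<^bsub>product_module I M\<^esub> f \<oplus>\<^bsub>product_module I M\<^esub> r \<odot>\<^bsub>product_module I M\<^esub> g"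
      by (rule ext) (simp_all add: add smult rfg nth module.smult_r_distr[OF M] mem)
  next
    fix f assume f: "f \<in> carrier (product_module I M)"
    have "\<one>\<^bsub>R\<^esub> \<in> carrier R" using R by (simp add: cring.cring_simprules)
    then show "\<one>\<^bsub>R\<^esub> \<odot>\<^bsub>product_module I M\<^esub> f = f"
      by (intro ext) (simp_all add: smult f nth module.smult_one[OF M] mem)
  qed
qed

text \<open>\<open>r\<close> acts as multiplication by its coset in the field
  \<open>R Quot I\<close>; this coset is zero iff \<open>r \<in> I\<close>, and a field has no zero
  divisors.\<close>

lemma (in maximalideal) residue_module_action:
  assumes "cring R" "r \<in> carrier R" "X \<in> carrier (R Quot I)"
  shows "r \<in> I \<Longrightarrow> r \<odot>\<^bsub>residue_module R I\<^esub> X = \<zero>\<^bsub>residue_module R I\<^esub>"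
    and "r \<notin> I \<Longrightarrow> r \<odot>\<^bsub>residue_module R I\<^esub> X = \<zero>\<^bsub>residue_module R I\<^esub> \<Longrightarrow>
      X = \<zero>\<^bsub>residue_module R I\<^esub>"
proof -
  interpret Q: field "R Quot I" using \<open>cring R\<close> by (rule quotient_is_field)
  interpret h: ring_hom_ring R "R Quot I" "(+>) I" by (rule rcos_ring_hom_ring)
  have I: "I +> r = \<zero>\<^bsub>R Quot I\<^esub> \<longleftrightarrow> r \<in> I"
    using a_rcos_const[of r] a_rcos_self[OF assms(2)] unfolding FactRing_def ring.simps by metis
  show "r \<in> I \<Longrightarrow> r \<odot>\<^bsub>residue_module R I\<^esub> X = \<zero>\<^bsub>residue_module R I\<^esub>"
    using I assms(3) by (simp add: residue_module_def)
  show "r \<notin> I \<Longrightarrow> r \<odot>\<^bsub>residue_module R I\<^esub> X = \<zero>\<^bsub>residue_module R I\<^esub> \<Longrightarrow>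
      X = \<zero>\<^bsub>residue_module R I\<^esub>"
    using I assms Q.integral_iff[of "I +> r" X] by (simp add: residue_module_def)
qed

lemma PP_imp_ex_module:
  assumes R: "cring R" and PP: "(p, n, cs, d) \<in> PP l R"
  shows "\<exists>M :: ('r, nat \<times> nat \<Rightarrow> 'r set) module. module R M \<and> card (carrier M) = p ^ n \<and>
    (\<forall>x\<in>carrier M. d \<odot>\<^bsub>M\<^esub> x = \<zero>\<^bsub>M\<^esub> \<longrightarrow> x = \<zero>\<^bsub>M\<^esub>) \<and>
    (\<forall>c\<in>set cs. \<forall>x\<in>carrier M. c \<odot>\<^bsub>M\<^esub> x = \<zero>\<^bsub>M\<^esub>)"
proof -
  from PP obtain s k \<mm> where cs: "set cs \<subseteq> carrier R" and d: "d \<in> carrier R"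
    and n: "n \<in> Span_nat s k" and \<mm>: "\<And>i. i < s \<Longrightarrow> maximalideal (\<mm> i) R"
    and card: "\<And>i. i < s \<Longrightarrow> card (carrier (R Quot \<mm> i)) = p ^ k i"
    and mem: "\<And>i c. i < s \<Longrightarrow> c \<in> set cs \<Longrightarrow> c \<in> \<mm> i" and nmem: "\<And>i. i < s \<Longrightarrow> d \<notin> \<mm> i"
    unfolding PP_def mem_Collect_eq split_conv by blast
  from n obtain e where e: "n = (\<Sum>i<s. e i * k i)" by (auto simp: Span_nat_def)
  \<comment> \<open>The coefficient \<open>e i\<close> becomes the multiplicity of the residue field
    of \<open>\<mm> i\<close>, with \<open>j < e i\<close> numbering the copies; a coefficient
    \<open>0\<close> leaves the field out.\<close>
  define I where "I = Sigma {..<s} (\<lambda>i. {..<e i})"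
  define M where "M = product_module I (\<lambda>ij. residue_module R (\<mm> (fst ij)))"
  have less: "fst ij < s" if "ij \<in> I" for ij using that by (auto simp: I_def)
  have nth: "x ij \<in> carrier (R Quot \<mm> (fst ij))" if "x \<in> carrier M" "ij \<in> I" for x ij
    using PiE_mem[of x I "\<lambda>ij. carrier (R Quot \<mm> (fst ij))" ij] that
    by (simp add: M_def product_module_def residue_module_def)
  have ext: "x = y" if "x \<in> carrier M" "y \<in> carrier M" "\<And>ij. ij \<in> I \<Longrightarrow> x ij = y ij" for x y
    using that unfolding M_def by (rule product_module_ext)
  have "module R M"
    unfolding M_def
    by (intro module_product_module module_residue_module R maximalideal.axioms(1)[OF \<mm>] less)
  then interpret module R M .
  have "card (carrier M) = (\<Prod>ij\<in>I. card (carrier (R Quot \<mm> (fst ij))))"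
    by (simp add: M_def product_module_def residue_module_def card_PiE I_def)
  also have "\<dots> = (\<Prod>ij\<in>I. p ^ k (fst ij))"
    by (rule prod.cong) (simp_all add: less card)
  also have "\<dots> = p ^ (\<Sum>ij\<in>I. k (fst ij))"
    by (simp add: power_sum)
  also have "(\<Sum>ij\<in>I. k (fst ij)) = n"
    using sum.Sigma[of "{..<s}" "\<lambda>i. {..<e i}" "\<lambda>i j. k i"] by (simp add: I_def e case_prod_unfold)
  finally have "card (carrier M) = p ^ n" .
  moreover have "x = \<zero>\<^bsub>M\<^esub>" if x: "x \<in> carrier M" and dx: "d \<odot>\<^bsub>M\<^esub> x = \<zero>\<^bsub>M\<^esub>" for x
  proof (rule ext)
    fix ij assume ij: "ij \<in> I"
    have "(d \<odot>\<^bsub>M\<^esub> x) ij = \<zero>\<^bsub>M\<^esub> ij" by (simp add: dx)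
    then have "d \<odot>\<^bsub>residue_module R (\<mm> (fst ij))\<^esub> x ij = \<zero>\<^bsub>residue_module R (\<mm> (fst ij))\<^esub>"
      using ij by (simp add: M_def product_module_def)
    then have "x ij = \<zero>\<^bsub>residue_module R (\<mm> (fst ij))\<^esub>"
      using maximalideal.residue_module_action(2)[OF \<mm> R d] nth[OF x ij] nmem less[OF ij] by blast
    then show "x ij = \<zero>\<^bsub>M\<^esub> ij"
      using ij by (simp add: M_def product_module_def)
  qed (use x in auto)
  moreover have "c \<odot>\<^bsub>M\<^esub> x = \<zero>\<^bsub>M\<^esub>" if c: "c \<in> set cs" and x: "x \<in> carrier M" for c x
  proof (rule ext)
    fix ij assume ij: "ij \<in> I"
    have "c \<odot>\<^bsub>residue_module R (\<mm> (fst ij))\<^esub> x ij = \<zero>\<^bsub>residue_module R (\<mm> (fst ij))\<^esub>"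
      using maximalideal.residue_module_action(1)[OF \<mm> R _ nth[OF x ij]] c cs mem less[OF ij]
      by blast
    then show "(c \<odot>\<^bsub>M\<^esub> x) ij = \<zero>\<^bsub>M\<^esub> ij"
      using ij by (simp add: M_def product_module_def)
  qed (use x c cs in auto)
  ultimately show ?thesis
    using \<open>module R M\<close> by blast
qed

section \<open>Composition factors of finite modules\<close>

definition adjoin :: "('r, 'b) ring_scheme \<Rightarrow> ('r, 'm, 'z) module_scheme \<Rightarrow> 'm set \<Rightarrow> 'm \<Rightarrow> 'm set" where
  "adjoin R M N x = {y \<oplus>\<^bsub>M\<^esub> r \<odot>\<^bsub>M\<^esub> x | y r. y \<in> N \<and> r \<in> carrier R}"

text \<open>The colon ideal \<open>(N : x)\<close>, the annihilator of the image of \<open>x\<close>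
  in \<open>M/N\<close>. It describes \<open>(N + Rx)/N\<close> through a quotient of
  \<open>R\<close>, so that quotient modules need not be formed.\<close>

definition transporter :: "('r, 'b) ring_scheme \<Rightarrow> ('r, 'm, 'z) module_scheme \<Rightarrow> 'm set \<Rightarrow> 'm \<Rightarrow> 'r set"
  where
  "transporter R M N x = {r \<in> carrier R. r \<odot>\<^bsub>M\<^esub> x \<in> N}"

context module
begin

lemma submodule_zero:
  assumes "submodule N R M"
  shows "\<zero>\<^bsub>M\<^esub> \<in> N"
  using subgroup.one_closed[OF submodule.axioms(1)[OF assms]] by simp

lemma submodule_minus:
  assumes N: "submodule N R M" and "x \<in> N" "y \<in> N"
  shows "x \<ominus>\<^bsub>M\<^esub> y \<in> N"
  using submoduleE[OF N] assms by (simp add: a_minus_def)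

lemma submodule_adjoin:
  assumes N: "submodule N R M" and x: "x \<in> carrier M"
  shows "submodule (adjoin R M N x) R M"
proof (rule submoduleI)
  note NE = submoduleE[OF N]
  note [simp] = subsetD[OF NE(1)]
  show "adjoin R M N x \<subseteq> carrier M"
    using x by (auto simp: adjoin_def)
  show "\<zero>\<^bsub>M\<^esub> \<in> adjoin R M N x"
    unfolding adjoin_def using submodule_zero[OF N] x
    by (intro CollectI exI[of _ "\<zero>\<^bsub>M\<^esub>"] exI[of _ "\<zero>"]) simp
  fix u assume u: "u \<in> adjoin R M N x"
  then obtain y r where yr: "y \<in> N" "r \<in> carrier R" "u = y \<oplus>\<^bsub>M\<^esub> r \<odot>\<^bsub>M\<^esub> x"
    by (auto simp: adjoin_def)
  have "\<ominus>\<^bsub>M\<^esub> u = \<ominus>\<^bsub>M\<^esub> y \<oplus>\<^bsub>M\<^esub> (\<ominus> r) \<odot>\<^bsub>M\<^esub> x"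
    using yr x by (simp add: M.minus_add smult_l_minus)
  then show "\<ominus>\<^bsub>M\<^esub> u \<in> adjoin R M N x"
    unfolding adjoin_def using yr NE(3) by blast
  {
    fix v assume "v \<in> adjoin R M N x"
    then obtain z s where zs: "z \<in> N" "s \<in> carrier R" "v = z \<oplus>\<^bsub>M\<^esub> s \<odot>\<^bsub>M\<^esub> x"
      by (auto simp: adjoin_def)
    have "u \<oplus>\<^bsub>M\<^esub> v = (y \<oplus>\<^bsub>M\<^esub> z) \<oplus>\<^bsub>M\<^esub> (r \<oplus> s) \<odot>\<^bsub>M\<^esub> x"
      using yr zs x by (simp add: smult_l_distr M.a_ac)
    then show "u \<oplus>\<^bsub>M\<^esub> v \<in> adjoin R M N x"
      unfolding adjoin_def using yr zs NE(5) by blast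
  next
    fix t assume t: "t \<in> carrier R"
    have "t \<odot>\<^bsub>M\<^esub> u = t \<odot>\<^bsub>M\<^esub> y \<oplus>\<^bsub>M\<^esub> (t \<otimes> r) \<odot>\<^bsub>M\<^esub> x"
      using yr t x by (simp add: smult_r_distr smult_assoc1)
    then show "t \<odot>\<^bsub>M\<^esub> u \<in> adjoin R M N x"
      unfolding adjoin_def using yr t NE(4) by blast
  }
qed

lemma adjoin_incl:
  assumes N: "submodule N R M" and x: "x \<in> carrier M"
  shows "N \<subseteq> adjoin R M N x" and "x \<in> adjoin R M N x"
proof -
  note [simp] = subsetD[OF submoduleE(1)[OF N]]
  have "y \<in> adjoin R M N x" if "y \<in> N" for y
    unfolding adjoin_def using that x
    by (intro CollectI exI[of _ y] exI[of _ "\<zero>"]) simp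
  then show "N \<subseteq> adjoin R M N x" by blast
  show "x \<in> adjoin R M N x"
    unfolding adjoin_def using submodule_zero[OF N] x
    by (intro CollectI exI[of _ "\<zero>\<^bsub>M\<^esub>"] exI[of _ "\<one>"]) simp
qed

lemma adjoin_mono:
  assumes N: "submodule N R M" and x: "x \<in> carrier M" and z: "z \<in> adjoin R M N x"
  shows "adjoin R M N z \<subseteq> adjoin R M N x"
proof
  note E = submoduleE[OF submodule_adjoin[OF N x]]
  fix u assume "u \<in> adjoin R M N z"
  then obtain y r where yr: "y \<in> N" "r \<in> carrier R" "u = y \<oplus>\<^bsub>M\<^esub> r \<odot>\<^bsub>M\<^esub> z"
    by (auto simp: adjoin_def)
  then show "u \<in> adjoin R M N x"
    using adjoin_incl(1)[OF N x] z E(4,5) by blast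
qed

lemma ideal_transporter:
  assumes N: "submodule N R M" and x: "x \<in> carrier M"
  shows "ideal (transporter R M N x) R"
proof (rule idealI)
  note NE = submoduleE[OF N]
  show "ring R" by (rule R.ring_axioms)
  show "subgroup (transporter R M N x) (add_monoid R)"
  proof (rule R.add.subgroupI)
    show "transporter R M N x \<noteq> {}"
      using submodule_zero[OF N] x by (auto simp: transporter_def intro!: exI[of _ "\<zero>"])
  qed (use NE x in \<open>auto simp: transporter_def smult_l_distr smult_l_minus simp flip: a_inv_def\<close>)
  fix a r assume "a \<in> transporter R M N x" and r: "r \<in> carrier R"
  then show "r \<otimes> a \<in> transporter R M N x"
    using NE(4) x by (auto simp: transporter_def smult_assoc1)
  then show "a \<otimes> r \<in> transporter R M N x"
    using \<open>a \<in> transporter R M N x\<close> r by (simp add: transporter_def R.m_comm)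
qed

text \<open>\<open>(N + Rx)/N\<close> is isomorphic to \<open>R/(N : x)\<close>: with a
  representative \<open>rep C\<close> chosen in every coset, each element of \<open>N + Rx\<close>
  is \<open>y + rep C x\<close> for exactly one \<open>y\<close> in \<open>N\<close> and one coset
  \<open>C\<close>.\<close>

lemma card_adjoin:
  assumes N: "submodule N R M" and x: "x \<in> carrier M"
  shows "card (adjoin R M N x) = card N * card (carrier (R Quot transporter R M N x))"
proof -
  let ?I = "transporter R M N x"
  note same_coset = R.quotient_eq_iff_same_a_r_cos[OF ideal_transporter[OF N x]]
  note NE = submoduleE[OF N]
  note [simp] = subsetD[OF NE(1)]
  have "\<exists>r\<in>carrier R. ?I +> r = C" if "C \<in> carrier (R Quot ?I)" for C
    using that by (auto simp: FactRing_simps)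
  then obtain rep where rep: "rep C \<in> carrier R" "?I +> rep C = C" if "C \<in> carrier (R Quot ?I)" for C
    by metis
  have coset: "?I +> r \<in> carrier (R Quot ?I)" if "r \<in> carrier R" for r
    using that by (auto simp: FactRing_simps)
  have "bij_betw (\<lambda>(y, C). y \<oplus>\<^bsub>M\<^esub> rep C \<odot>\<^bsub>M\<^esub> x) (N \<times> carrier (R Quot ?I)) (adjoin R M N x)"
    unfolding bij_betw_def
  proof
    show "inj_on (\<lambda>(y, C). y \<oplus>\<^bsub>M\<^esub> rep C \<odot>\<^bsub>M\<^esub> x) (N \<times> carrier (R Quot ?I))"
    proof (rule inj_onI, clarify)
      fix y C z D
      assume y: "y \<in> N" and C: "C \<in> carrier (R Quot ?I)" and z: "z \<in> N"
        and D: "D \<in> carrier (R Quot ?I)"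
        and eq: "y \<oplus>\<^bsub>M\<^esub> rep C \<odot>\<^bsub>M\<^esub> x = z \<oplus>\<^bsub>M\<^esub> rep D \<odot>\<^bsub>M\<^esub> x"
      note [simp] = rep(1)[OF C] rep(1)[OF D] y z x
      \<comment> \<open>Comparing the two sums shows that the difference of the representatives
        sends \<open>x\<close> into \<open>N\<close>, so they lie in the same coset.\<close>
      have "(rep C \<ominus> rep D) \<odot>\<^bsub>M\<^esub> x = rep C \<odot>\<^bsub>M\<^esub> x \<ominus>\<^bsub>M\<^esub> rep D \<odot>\<^bsub>M\<^esub> x"
        by (simp add: a_minus_def smult_l_distr smult_l_minus)
      also have "\<dots> = z \<ominus>\<^bsub>M\<^esub> y"
      proof -
        have "rep C \<odot>\<^bsub>M\<^esub> x = \<ominus>\<^bsub>M\<^esub> y \<oplus>\<^bsub>M\<^esub> (y \<oplus>\<^bsub>M\<^esub> rep C \<odot>\<^bsub>M\<^esub> x)"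
          by (simp add: M.r_neg1)
        also have "\<dots> = (z \<ominus>\<^bsub>M\<^esub> y) \<oplus>\<^bsub>M\<^esub> rep D \<odot>\<^bsub>M\<^esub> x"
          by (simp add: eq a_minus_def M.a_ac)
        finally show ?thesis
          by (simp add: a_minus_def M.a_assoc M.r_neg)
      qed
      finally have "(rep C \<ominus> rep D) \<odot>\<^bsub>M\<^esub> x \<in> N"
        using submodule_minus[OF N z y] by (simp only:)
      then have "rep C \<ominus> rep D \<in> ?I"
        using R.minus_closed[OF rep(1)[OF C] rep(1)[OF D]] by (simp only: transporter_def) blast
      then have "C = D"
        using same_coset[OF rep(1)[OF C] rep(1)[OF D]] rep(2)[OF C] rep(2)[OF D]
        by simp
      with eq show "y = z \<and> C = D" by simp
    qed
    show "(\<lambda>(y, C). y \<oplus>\<^bsub>M\<^esub> rep C \<odot>\<^bsub>M\<^esub> x) ` (N \<times> carrier (R Quot ?I)) = adjoin R M N x"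
    proof safe
      fix y C assume "y \<in> N" "C \<in> carrier (R Quot ?I)"
      then show "y \<oplus>\<^bsub>M\<^esub> rep C \<odot>\<^bsub>M\<^esub> x \<in> adjoin R M N x"
        using rep(1) by (auto simp: adjoin_def)
    next
      fix u assume "u \<in> adjoin R M N x"
      then obtain y r where y: "y \<in> N" and r: "r \<in> carrier R" and u: "u = y \<oplus>\<^bsub>M\<^esub> r \<odot>\<^bsub>M\<^esub> x"
        by (auto simp: adjoin_def)
      define C where "C = ?I +> r"
      have C: "C \<in> carrier (R Quot ?I)" unfolding C_def by (rule coset[OF r])
      note [simp] = rep(1)[OF C] y r x
      \<comment> \<open>Replacing \<open>r\<close> by the representative of its coset changes
        \<open>r x\<close> by an element of \<open>N\<close>, which is absorbed into the first
        summand.\<close>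
      have "r \<ominus> rep C \<in> ?I"
        using same_coset[OF r rep(1)[OF C]] rep(2)[OF C] by (simp add: C_def)
      then have N': "(r \<ominus> rep C) \<odot>\<^bsub>M\<^esub> x \<in> N" by (simp add: transporter_def)
      have "r = (r \<ominus> rep C) \<oplus> rep C"
        by (simp add: a_minus_def R.a_assoc R.l_neg)
      then have "r \<odot>\<^bsub>M\<^esub> x = (r \<ominus> rep C) \<odot>\<^bsub>M\<^esub> x \<oplus>\<^bsub>M\<^esub> rep C \<odot>\<^bsub>M\<^esub> x"
        using smult_l_distr[of "r \<ominus> rep C" "rep C" x] by simp
      then have "u = (y \<oplus>\<^bsub>M\<^esub> (r \<ominus> rep C) \<odot>\<^bsub>M\<^esub> x) \<oplus>\<^bsub>M\<^esub> rep C \<odot>\<^bsub>M\<^esub> x"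
        by (simp add: u M.a_assoc)
      moreover have "y \<oplus>\<^bsub>M\<^esub> (r \<ominus> rep C) \<odot>\<^bsub>M\<^esub> x \<in> N"
        using N' NE(5) by simp
      ultimately show "u \<in> (\<lambda>(y, C). y \<oplus>\<^bsub>M\<^esub> rep C \<odot>\<^bsub>M\<^esub> x) ` (N \<times> carrier (R Quot ?I))"
        using C by (intro image_eqI[of _ _ "(y \<oplus>\<^bsub>M\<^esub> (r \<ominus> rep C) \<odot>\<^bsub>M\<^esub> x, C)"]) auto
    qed
  qed
  then have "card (N \<times> carrier (R Quot ?I)) = card (adjoin R M N x)"
    by (rule bij_betw_same_card)
  then show ?thesis by (simp add: card_cartesian_product)
qed

text \<open>The last hypothesis says that \<open>(N + Rx)/N\<close> is simple. For \<open>r\<close>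
  outside the transporter, \<open>r x\<close> therefore generates \<open>x\<close> modulo
  \<open>N\<close>: \<open>x = y + s r x\<close> with \<open>y\<close> in \<open>N\<close>. So
  \<open>1 - s r\<close> lies in the transporter, and a larger ideal containing \<open>r\<close>
  contains \<open>1\<close>.\<close>

lemma maximalideal_transporter:
  assumes N: "submodule N R M" and x: "x \<in> carrier M" "x \<notin> N"
    and min: "\<And>z. z \<in> adjoin R M N x \<Longrightarrow> z \<notin> N \<Longrightarrow> x \<in> adjoin R M N z"
  shows "maximalideal (transporter R M N x) R"
proof (rule maximalidealI)
  let ?I = "transporter R M N x"
  note NE = submoduleE[OF N]
  show ideal: "ideal ?I R" by (rule ideal_transporter[OF N x(1)])
  show "carrier R \<noteq> ?I"
  proof
    assume "carrier R = ?I"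
    then have "\<one> \<in> ?I" using R.one_closed by simp
    then show False using x by (simp add: transporter_def)
  qed
  fix J assume J: "ideal J R" and sub: "?I \<subseteq> J" "J \<subseteq> carrier R"
  interpret J: ideal J R by fact
  show "J = ?I \<or> J = carrier R"
  proof (rule disjCI)
    assume "J \<noteq> carrier R"
    show "J = ?I"
    proof (rule ccontr)
      assume "J \<noteq> ?I"
      then obtain r where r: "r \<in> J" "r \<notin> ?I" using sub by blast
      then have rR: "r \<in> carrier R" using sub by blast
      with r have rx: "r \<odot>\<^bsub>M\<^esub> x \<notin> N" by (simp add: transporter_def)
      have "r \<odot>\<^bsub>M\<^esub> x \<in> adjoin R M N x"
        using submoduleE(4)[OF submodule_adjoin[OF N x(1)] rR] adjoin_incl(2)[OF N x(1)] by blast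
      then have "x \<in> adjoin R M N (r \<odot>\<^bsub>M\<^esub> x)" using rx by (rule min)
      then obtain y s where ys: "y \<in> N" "s \<in> carrier R" "x = y \<oplus>\<^bsub>M\<^esub> s \<odot>\<^bsub>M\<^esub> (r \<odot>\<^bsub>M\<^esub> x)"
        by (auto simp: adjoin_def)
      have y: "y \<in> carrier M" using ys NE(1) by blast
      have "(\<one> \<ominus> s \<otimes> r) \<odot>\<^bsub>M\<^esub> x = x \<ominus>\<^bsub>M\<^esub> s \<odot>\<^bsub>M\<^esub> (r \<odot>\<^bsub>M\<^esub> x)"
        using ys(2) rR x(1) by (simp add: a_minus_def smult_l_distr smult_l_minus smult_assoc1)
      also have "\<dots> = (y \<oplus>\<^bsub>M\<^esub> s \<odot>\<^bsub>M\<^esub> (r \<odot>\<^bsub>M\<^esub> x)) \<ominus>\<^bsub>M\<^esub> s \<odot>\<^bsub>M\<^esub> (r \<odot>\<^bsub>M\<^esub> x)"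
        by (simp only: ys(3)[symmetric])
      also have "\<dots> = y"
        using ys(2) rR x(1) y by (simp add: a_minus_def M.a_assoc M.r_neg)
      finally have "\<one> \<ominus> s \<otimes> r \<in> ?I"
        using ys rR by (simp add: transporter_def)
      then have "\<one> \<ominus> s \<otimes> r \<in> J" using sub by blast
      moreover have "s \<otimes> r \<in> J" using J.I_l_closed[OF r(1) ys(2)] .
      ultimately have "(\<one> \<ominus> s \<otimes> r) \<oplus> s \<otimes> r \<in> J" by (rule J.a_closed)
      moreover have "(\<one> \<ominus> s \<otimes> r) \<oplus> s \<otimes> r = \<one>"
        using ys(2) rR by (simp add: a_minus_def R.a_assoc R.l_neg)
      ultimately have "J = carrier R" using J.one_imp_carrier by simp
      with \<open>J \<noteq> carrier R\<close> show False by simp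
    qed
  qed
qed

text \<open>Among the \<open>x\<close> outside \<open>N\<close>, one with the smallest
  \<open>N + Rx\<close> is taken. For \<open>z\<close> in \<open>N + Rx\<close> but outside
  \<open>N\<close>, the set \<open>N + Rz\<close> is contained in \<open>N + Rx\<close> and not
  smaller, so finiteness makes them equal.\<close>

lemma ex_minimal_adjoin:
  assumes fin: "finite (carrier M)" and N: "submodule N R M" and "N \<noteq> carrier M"
  obtains x where "x \<in> carrier M" "x \<notin> N" "maximalideal (transporter R M N x) R"
proof -
  have "carrier M - N \<noteq> {}" using assms submoduleE(1)[OF N] by blast
  then obtain x where x: "x \<in> carrier M - N"
    and min: "\<And>z. z \<in> carrier M - N \<Longrightarrow> card (adjoin R M N x) \<le> card (adjoin R M N z)"
    using ex_has_least_nat[of "\<lambda>x. x \<in> carrier M - N" _ "\<lambda>x. card (adjoin R M N x)"] by blast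
  have xM: "x \<in> carrier M" using x by blast
  note sub = submoduleE(1)[OF submodule_adjoin[OF N xM]]
  have "maximalideal (transporter R M N x) R"
  proof (rule maximalideal_transporter[OF N])
    fix z assume z: "z \<in> adjoin R M N x" "z \<notin> N"
    then have zM: "z \<in> carrier M" using sub by blast
    have "adjoin R M N z = adjoin R M N x"
      using adjoin_mono[OF N xM z(1)] min[of z] z zM finite_subset[OF sub fin]
      by (intro card_seteq) auto
    then show "x \<in> adjoin R M N z" using adjoin_incl(2)[OF N xM] by simp
  qed (use x in auto)
  with x that show thesis by blast
qed

text \<open>A composition series is climbed from \<open>N\<close> upwards, one simple factor at a
  time, while \<open>card (carrier M) - card N\<close> decreases. The general \<open>N\<close> is
  there for the induction; the zero submodule gives all factors.\<close>

lemma ex_composition_factors: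
  assumes fin: "finite (carrier M)" and d: "d \<in> carrier R"
    and inj: "\<And>x. x \<in> carrier M \<Longrightarrow> d \<odot>\<^bsub>M\<^esub> x = \<zero>\<^bsub>M\<^esub> \<Longrightarrow> x = \<zero>\<^bsub>M\<^esub>"
    and A: "A \<subseteq> carrier R" "\<And>c x. c \<in> A \<Longrightarrow> x \<in> carrier M \<Longrightarrow> c \<odot>\<^bsub>M\<^esub> x = \<zero>\<^bsub>M\<^esub>"
    and N: "submodule N R M"
  shows "\<exists>ms. card (carrier M) = card N * (\<Prod>\<mm>\<leftarrow>ms. card (carrier (R Quot \<mm>))) \<and>
    (\<forall>\<mm>\<in>set ms. maximalideal \<mm> R \<and> A \<subseteq> \<mm> \<and> d \<notin> \<mm>)"
  using N
proof (induction "card (carrier M) - card N" arbitrary: N rule: less_induct)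
  case less
  note N = less.prems
  note NE = submoduleE[OF N]
  have finN: "finite N" using NE(1) fin by (rule finite_subset)
  show ?case
  proof (cases "N = carrier M")
    case True
    then show ?thesis by (intro exI[of _ "[]"]) simp
  next
    case False
    then obtain x where x: "x \<in> carrier M" "x \<notin> N"
      and max: "maximalideal (transporter R M N x) R"
      using ex_minimal_adjoin[OF fin N] by blast
    let ?\<mm> = "transporter R M N x" and ?N = "adjoin R M N x"
    have sub: "?N \<subseteq> carrier M" by (rule submoduleE(1)[OF submodule_adjoin[OF N x(1)]])
    have "card N < card ?N"
      using adjoin_incl[OF N x(1)] x(2) finite_subset[OF sub fin] by (intro psubset_card_mono) auto
    moreover have "card ?N \<le> card (carrier M)" by (rule card_mono[OF fin sub])
    ultimately have "card (carrier M) - card ?N < card (carrier M) - card N" by simp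
    then obtain ms where ms: "card (carrier M) = card ?N * (\<Prod>\<mm>\<leftarrow>ms. card (carrier (R Quot \<mm>)))"
      "\<forall>\<mm>\<in>set ms. maximalideal \<mm> R \<and> A \<subseteq> \<mm> \<and> d \<notin> \<mm>"
      using less.hyps submodule_adjoin[OF N x(1)] by blast
    have "A \<subseteq> ?\<mm>"
      using A x(1) submodule_zero[OF N] by (auto simp: transporter_def)
    moreover have "d \<notin> ?\<mm>"
    proof
      assume "d \<in> ?\<mm>"
      then have dx: "d \<odot>\<^bsub>M\<^esub> x \<in> N" by (simp add: transporter_def)
      have inj_d: "inj_on (\<lambda>y. d \<odot>\<^bsub>M\<^esub> y) (carrier M)"
      proof (rule inj_onI)
        fix y z assume yz: "y \<in> carrier M" "z \<in> carrier M" "d \<odot>\<^bsub>M\<^esub> y = d \<odot>\<^bsub>M\<^esub> z"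
        then have "d \<odot>\<^bsub>M\<^esub> (y \<ominus>\<^bsub>M\<^esub> z) = \<zero>\<^bsub>M\<^esub>"
          using d by (simp add: a_minus_def smult_r_distr smult_r_minus M.r_neg)
        then have "y \<ominus>\<^bsub>M\<^esub> z = \<zero>\<^bsub>M\<^esub>" using yz inj[OF M.minus_closed] by blast
        then have "y = \<ominus>\<^bsub>M\<^esub> (\<ominus>\<^bsub>M\<^esub> z)"
          using yz M.minus_equality[of y "\<ominus>\<^bsub>M\<^esub> z"] by (simp add: a_minus_def)
        then show "y = z" using yz by simp
      qed
      \<comment> \<open>An injective map of a finite set into itself is onto. So \<open>d x\<close>
        in \<open>N\<close> has a preimage in \<open>N\<close>, which injectivity on all of
        \<open>M\<close> identifies with \<open>x\<close>.\<close>
      have "(\<lambda>y. d \<odot>\<^bsub>M\<^esub> y) ` N = N"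
        using NE(4)[OF d] finN inj_on_subset[OF inj_d NE(1)] by (intro endo_inj_surj) auto
      then obtain y where "y \<in> N" "d \<odot>\<^bsub>M\<^esub> y = d \<odot>\<^bsub>M\<^esub> x" using dx by force
      then have "y = x" using inj_onD[OF inj_d] x(1) NE(1) by blast
      with \<open>y \<in> N\<close> x(2) show False by simp
    qed
    ultimately show ?thesis
      using ms max by (intro exI[of _ "?\<mm> # ms"]) (simp add: card_adjoin[OF N x(1)] mult.assoc)
  qed
qed

lemma module_imp_PP:
  assumes p: "Factorial_Ring.prime p" and n: "n > 0" and card: "card (carrier M) = p ^ n"
    and d: "d \<in> carrier R"
    and inj: "\<And>x. x \<in> carrier M \<Longrightarrow> d \<odot>\<^bsub>M\<^esub> x = \<zero>\<^bsub>M\<^esub> \<Longrightarrow> x = \<zero>\<^bsub>M\<^esub>"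
    and cs: "set cs \<subseteq> carrier R"
    and ann: "\<And>c x. c \<in> set cs \<Longrightarrow> x \<in> carrier M \<Longrightarrow> c \<odot>\<^bsub>M\<^esub> x = \<zero>\<^bsub>M\<^esub>"
  shows "(p, n, cs, d) \<in> PP (length cs) R"
proof -
  have p1: "p > 1" using p by (rule prime_gt_1_nat)
  have fin: "finite (carrier M)" using card p1 by (intro card_ge_0_finite) simp
  have "submodule {\<zero>\<^bsub>M\<^esub>} R M"
    by (rule submoduleI) auto
  from ex_composition_factors[OF fin d inj cs ann this]
  obtain ms where ms: "p ^ n = (\<Prod>\<mm>\<leftarrow>ms. card (carrier (R Quot \<mm>)))"
    and ms': "\<And>\<mm>. \<mm> \<in> set ms \<Longrightarrow> maximalideal \<mm> R \<and> set cs \<subseteq> \<mm> \<and> d \<notin> \<mm>"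
    by (auto simp: card)
  \<comment> \<open>The order of a factor divides \<open>p ^ n\<close>, hence is a power of
    \<open>p\<close>; the exponent is positive because \<open>0\<close> and \<open>1\<close> differ
    in a field.\<close>
  have "\<exists>k>0. card (carrier (R Quot \<mm>)) = p ^ k" if "\<mm> \<in> set ms" for \<mm>
  proof -
    interpret m: maximalideal \<mm> R using ms'[OF that] by blast
    interpret Q: field "R Quot \<mm>" by (rule m.quotient_is_field) (rule R.is_cring)
    have "card (carrier (R Quot \<mm>)) dvd p ^ n"
      unfolding ms using that by (intro prod_list_dvd) auto
    then obtain k where k: "card (carrier (R Quot \<mm>)) = p ^ k"
      using p by (auto simp: divides_primepow_nat)
    have "k \<noteq> 0"
    proof
      assume "k = 0"
      then obtain a where "carrier (R Quot \<mm>) = {a}" using k by (auto simp: card_1_singleton_iff)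
      then show False using Q.one_closed Q.zero_closed Q.one_not_zero by (metis singletonD)
    qed
    with k show ?thesis by blast
  qed
  then obtain k where k: "k \<mm> > 0" "card (carrier (R Quot \<mm>)) = p ^ k \<mm>" if "\<mm> \<in> set ms" for \<mm>
    by metis
  have "p ^ n = (\<Prod>\<mm>\<leftarrow>ms. p ^ k \<mm>)"
    unfolding ms by (intro arg_cong[of _ _ prod_list] map_cong) (auto simp: k)
  also have "\<dots> = p ^ (\<Sum>\<mm>\<leftarrow>ms. k \<mm>)"
    by (induction ms) (simp_all add: power_add)
  finally have "n = (\<Sum>\<mm>\<leftarrow>ms. k \<mm>)" using p1 by simp
  then have n_eq: "n = (\<Sum>i<length ms. k (ms ! i))"
    by (simp add: sum_list_sum_nth lessThan_atLeast0)
  \<comment> \<open>An empty list would make the exponent sum \<open>0\<close>; thus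
    \<open>n > 0\<close> provides the condition \<open>s > 0\<close>.\<close>
  have "ms \<noteq> []" using n n_eq by auto
  moreover have "n \<in> Span_nat (length ms) (\<lambda>i. k (ms ! i))"
    \<comment> \<open>Repeated factors occupy separate places in \<open>ms\<close>, so every
      coefficient can be \<open>1\<close>.\<close>
    unfolding Span_nat_def using n_eq by (intro CollectI exI[of _ "\<lambda>_. 1"]) simp
  moreover have "c \<in> ms ! i" if "i < length ms" "c \<in> set cs" for i c
    using ms'[OF nth_mem] that by blast
  ultimately show ?thesis
    unfolding PP_def using p n cs d k ms'
    by (auto intro!: exI[of _ "length ms"] exI[of _ "\<lambda>i. k (ms ! i)"] exI[of _ "\<lambda>i. ms ! i"])
qed

end

section \<open>Reduction to the theory of modules\<close>

text \<open>The set \<open>Z\<close> allows for additional zero coefficients in \<open>c\<close>,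
  which annihilate every module; they arise when a coded list is read past its end.\<close>

lemma PP_iff_not_in_theory:
  assumes R: "cring R" "countable (carrier R)"
    and p: "Factorial_Ring.prime p" and n: "n > 0"
    and cs: "set cs \<subseteq> carrier R" and d: "d \<in> carrier R"
    and c: "c ` {..<m} = set cs \<union> Z" "Z \<subseteq> {\<zero>\<^bsub>R\<^esub>}"
  shows "(p, n, cs, d) \<in> PP (length cs) R \<longleftrightarrow> Neg (module_fm (p ^ n) d m c) \<notin> module_theory R"
proof -
  let ?\<sigma> = "module_fm (p ^ n) d m c"
  interpret R: cring R by fact
  have pn: "p ^ n > 0" using p by (simp add: prime_gt_0_nat)
  have "coeffs_fm ?\<sigma> \<subseteq> carrier R"
    using cs d c by (auto simp: coeffs_module_fm)
  then have sentence: "Neg ?\<sigma> \<in> sentences R"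
    by (simp add: sentences_def fv_module_fm)
  show ?thesis
  proof
    assume "(p, n, cs, d) \<in> PP (length cs) R"
    then obtain M :: "('a, nat \<times> nat \<Rightarrow> 'a set) module" where M: "module R M"
      and card: "card (carrier M) = p ^ n"
      and inj: "\<forall>x\<in>carrier M. d \<odot>\<^bsub>M\<^esub> x = \<zero>\<^bsub>M\<^esub> \<longrightarrow> x = \<zero>\<^bsub>M\<^esub>"
      and ann: "\<forall>c\<in>set cs. \<forall>x\<in>carrier M. c \<odot>\<^bsub>M\<^esub> x = \<zero>\<^bsub>M\<^esub>"
      using PP_imp_ex_module[OF R(1)] by blast
    interpret M: module R M by fact
    have "c i \<odot>\<^bsub>M\<^esub> x = \<zero>\<^bsub>M\<^esub>" if "i < m" "x \<in> carrier M" for i x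
    proof -
      have "c i \<in> set cs \<union> Z" using that c(1) by blast
      then show ?thesis using ann c(2) that(2) by auto
    qed
    then have sat: "sat M v ?\<sigma>" for v
      using card inj by (simp add: sat_module_fm[OF pn])
    show "Neg ?\<sigma> \<notin> module_theory R"
    proof
      assume "Neg ?\<sigma> \<in> module_theory R"
      \<comment> \<open>The elements of \<open>M\<close> are functions, so the definition of
        \<open>module_theory\<close> does not apply directly; its soundness for arbitrary carrier
        types does.\<close>
      then have "M \<Turnstile> Neg ?\<sigma>" by (rule module_theory_sound[OF R(2) _ M])
      then have "\<not> sat M (\<lambda>_. \<zero>\<^bsub>M\<^esub>) ?\<sigma>"
        by (auto simp: models_def)
      with sat show False by blast
    qed
  next
    assume "Neg ?\<sigma> \<notin> module_theory R"
    with sentence obtain M :: "('a, nat) module" and v where M: "module R M" and "sat M v ?\<sigma>"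
      by (auto simp: module_theory_def models_def)
    then have *: "card (carrier M) = p ^ n"
      "\<And>x. x \<in> carrier M \<Longrightarrow> d \<odot>\<^bsub>M\<^esub> x = \<zero>\<^bsub>M\<^esub> \<Longrightarrow> x = \<zero>\<^bsub>M\<^esub>"
      "\<And>i x. i < m \<Longrightarrow> x \<in> carrier M \<Longrightarrow> c i \<odot>\<^bsub>M\<^esub> x = \<zero>\<^bsub>M\<^esub>"
      by (auto simp: sat_module_fm[OF pn])
    have "e \<odot>\<^bsub>M\<^esub> x = \<zero>\<^bsub>M\<^esub>" if "e \<in> set cs" "x \<in> carrier M" for e x
    proof -
      have "e \<in> c ` {..<m}" using that c(1) by blast
      then show ?thesis using *(3) that(2) by auto
    qed
    then show "(p, n, cs, d) \<in> PP (length cs) R"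
      using module.module_imp_PP[OF M p n *(1) d *(2) cs] by blast
  qed
qed

section \<open>Decoding tuples into sentences\<close>

lemma mem_PP_star_iff: "(p, n, cs, d) \<in> PP_star R \<longleftrightarrow> cs \<noteq> [] \<and> (p, n, cs, d) \<in> PP (length cs) R"
proof -
  have "l = length cs" if "(p, n, cs, d) \<in> PP l R" for l
    using that by (simp add: PP_def)
  then show ?thesis
    by (cases cs) (auto simp: PP_star_def Suc_le_eq)
qed

text \<open>
  The bound \<open>(code_tl ^^ 3) x\<close> exceeds the length of the list it codes; the surplus entries are
  read as \<open>0\<close>, and \<open>a 0 = \<zero>\<close> annihilates every module.
\<close>

definition tuple_fm :: "nat \<Rightarrow> nat fm" where
  "tuple_fm x = module_fm (code_hd x ^ code_hd (code_tl x)) (code_hd ((code_tl ^^ 2) x))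
    ((code_tl ^^ 3) x) (\<lambda>i. code_hd ((code_tl ^^ i) ((code_tl ^^ 3) x)))"

lemma recursive_tuple_fm: "recursive_fun 1 (\<lambda>xs. code_fm (tuple_fm (xs ! 0)))"
proof -
  have tl: "recursive_fun (Suc 1) (\<lambda>ys. tl ys ! 0)"
    by (rule recursive_fun.ext[OF recursive_fun.proj[of 1]]) (auto simp: nth_tl)
  then show ?thesis
    unfolding tuple_fm_def
    by (intro recursive_module_fm recursive_power recursive_code_hd recursive_code_tl
        recursive_code_drop recursive_const recursive_fun.proj tl) simp_all
qed

text \<open>Only the empty list has code \<open>0\<close>, so \<open>0 < (code_tl ^^ 3) x\<close>
  says that something follows \<open>p\<close>, \<open>n\<close> and the index \<open>j\<close> of
  \<open>d\<close>. This excludes lists that are too short and enforces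
  \<open>l \<ge> 1\<close>.\<close>

lemma mem_tuples_iff:
  assumes a: "effectively_given R a"
  shows "x \<in> {list_encode (p # n # j # is) | p n is j. (p, n, map a is, a j) \<in> PP_star R} \<longleftrightarrow>
    Factorial_Ring.prime (code_hd x) \<and> 0 < code_hd (code_tl x) \<and> 0 < (code_tl ^^ 3) x \<and>
    code_fm (Neg (tuple_fm x)) \<notin> {code_fm \<phi> | \<phi>. map_fm a \<phi> \<in> module_theory R}"
    (is "x \<in> ?X \<longleftrightarrow> ?P")
proof -
  note [simp] = list_encode_eq and [simp del] = list_encode.simps
  have dom: "domain R" and ran: "range a = carrier R" and a0: "a 0 = \<zero>\<^bsub>R\<^esub>"
    using a by (auto simp: effectively_given_def)
  have R: "cring R" using dom by (rule domain.axioms)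
  have count: "countable (carrier R)" by (simp flip: ran)
  have in_R: "a i \<in> carrier R" for i using ran by blast
  have code_mem: "code_fm \<phi> \<in> {code_fm \<phi> | \<phi>. map_fm a \<phi> \<in> module_theory R} \<longleftrightarrow>
      map_fm a \<phi> \<in> module_theory R" for \<phi>
    using code_fm_inject by blast
  obtain xs where x: "x = list_encode xs"
    by (metis list_decode_inverse)
  have long: "0 < (code_tl ^^ 3) x \<longleftrightarrow> (\<exists>p n j is. xs = p # n # j # is \<and> is \<noteq> [])"
  proof -
    have "0 < list_encode ys \<longleftrightarrow> ys \<noteq> []" for ys
      by (cases ys) (simp_all add: list_encode.simps)
    then have "0 < (code_tl ^^ 3) x \<longleftrightarrow> drop 3 xs \<noteq> []" by (simp only: x code_drop_encode)
    also have "\<dots> \<longleftrightarrow> (\<exists>p n j is. xs = p # n # j # is \<and> is \<noteq> [])"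
      by (cases xs; cases "tl xs"; cases "tl (tl xs)") (auto simp: numeral_3_eq_3)
    finally show ?thesis .
  qed
  show ?thesis
  proof (cases "0 < (code_tl ^^ 3) x")
    case False
    then have "x \<notin> ?X" using long by (auto simp: x mem_PP_star_iff)
    with False show ?thesis by blast
  next
    case True
    then obtain p n j "is" where xs: "xs = p # n # j # is" and "is": "is \<noteq> []"
      using long by blast
    define c where "c = (\<lambda>i. a (code_hd ((code_tl ^^ i) (list_encode is))))"
    have heads: "code_hd x = p" "code_hd (code_tl x) = n" "code_hd ((code_tl ^^ 2) x) = j"
      "(code_tl ^^ 3) x = list_encode is"
      unfolding x xs code_drop_encode by (simp_all add: code_tl_encode code_hd_encode)
    have sentence: "map_fm a (Neg (tuple_fm x)) = Neg (module_fm (p ^ n) (a j) (list_encode is) c)"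
      unfolding tuple_fm_def heads by (simp add: map_module_fm c_def)
    have c_nth: "c i = (if i < length is then a (is ! i) else \<zero>\<^bsub>R\<^esub>)" for i
      by (simp add: c_def code_nth_encode a0)
    have "set (map a is) \<subseteq> c ` {..<list_encode is}"
    proof
      fix y assume "y \<in> set (map a is)"
      then obtain i where "i < length is" "y = a (is ! i)" by (auto simp: in_set_conv_nth)
      then show "y \<in> c ` {..<list_encode is}"
        using length_le_list_encode[of "is"] by (intro image_eqI[of _ _ i]) (auto simp: c_nth)
    qed
    moreover have "c ` {..<list_encode is} \<subseteq> set (map a is) \<union> {\<zero>\<^bsub>R\<^esub>}"
      by (auto simp: c_nth)
    \<comment> \<open>Besides the entries of \<open>map a is\<close> only zero can occur, from
      reading past the end; the intersection accounts for it without deciding whether it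
      does.\<close>
    ultimately have c: "c ` {..<list_encode is} = set (map a is) \<union> (c ` {..<list_encode is} \<inter> {\<zero>\<^bsub>R\<^esub>})"
      by blast
    have "x \<in> ?X \<longleftrightarrow> (p, n, map a is, a j) \<in> PP (length (map a is)) R"
      using "is" by (auto simp: x xs mem_PP_star_iff)
    also have "\<dots> \<longleftrightarrow> Factorial_Ring.prime p \<and> n > 0 \<and>
        Neg (module_fm (p ^ n) (a j) (list_encode is) c) \<notin> module_theory R"
    proof (cases "Factorial_Ring.prime p \<and> n > 0")
      case True
      then show ?thesis
        using PP_iff_not_in_theory[OF R count _ _ _ in_R c Int_lower2, of p n j] in_R by auto
    qed (auto simp: PP_def)
    finally show ?thesis
      using True by (simp only: heads code_mem sentence simp_thms)
  qed
qed

theorem theorem3p2: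
  fixes R :: "('r, 'b) ring_scheme" and a :: "nat \<Rightarrow> 'r"
  assumes "effectively_given R a"
    and "prufer_domain R"
    and "decidable_theory a (module_theory R)"
  shows "recursive_tuples a (PP_star R)"
proof -
  have "recursive_fun 1 (\<lambda>xs. code_fm (Neg (tuple_fm (xs ! 0))))"
    using recursive_prod_encode[OF recursive_const recursive_tuple_fm] by simp
  \<comment> \<open>The decision procedure for the theory is composed with the recursive map to
    codes; the negation of this relation is the query in the final characterization.\<close>
  then have "recursive_rel 1 (\<lambda>xs. code_fm (Neg (tuple_fm (xs ! 0))) \<in>
      {code_fm \<phi> | \<phi>. map_fm a \<phi> \<in> module_theory R})"
    using assms(3) unfolding decidable_theory_def by (intro recursive_rel_mem)
  then show ?thesis
    unfolding recursive_tuples_def recursive_set_def mem_tuples_iff[OF assms(1)]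
    by (intro recursive_rel_conj recursive_rel_not recursive_rel_prime recursive_rel_less
        recursive_code_hd recursive_code_tl recursive_code_drop recursive_const
        recursive_fun.proj) simp_all
qed

end
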